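(* Let $\theta$ be a stationary function of $\mathcal E$ for the fixed-boundary (Dirichlet) problem and let $\gamma(s)=(\theta(s),\theta'(s))$, $s\in[a,b]$, be its phase-plane trajectory. Suppose $I[\gamma]=1$, where $I[\gamma]=\#\{s\in[a,b]:\theta'(s)=0\}$, with the unique zero $c$ of $\theta'$ lying in $(a,b)$. Let $E_0$ be the pseudo-energy of $\theta$ and let $L(E)$ be the length function of $\gamma$, defined for $E$ near $E_0$. Then: (1) if $\frac{\partial L}{\partial E}(E_0)>0$, then $\theta$ is locally minimal for $\mathcal E$ on $\mathcal D^D([a,b])$; (2) if $\frac{\partial L}{\partial E}(E_0)<0$, then $\theta$ is not locally minimal for $\mathcal E$ on $\mathcal D^D([a,b])$.
   Context: Let $a<b$ be real numbers, $A\in\mathbb R$, and let $V:\mathbb R\to\mathbb R$ be of class $C^2$ such that $V_\theta=dV/d\theta$ and $V_{\theta\theta}=d^2V/d\theta^2$ have no common zero. For $\theta\in C^1([a,b])$ set $\mathcal E[\theta]=\int_a^b\left(\frac{(\theta'(s)-A)^2}{2}-V(\theta(s))\right)ds$. Fixed boundaries: $\theta(a)=T_a$ and $\theta(b)=T_b$ are prescribed. Let $\mathcal C^D([a,b])=\{\tau\in C^1([a,b]):\tau(a)=\tau(b)=0\}\setminus\{0\}$ and $\mathcal D^D([a,b])=\{\tau\in C^2([a,b])\setminus\{0\}:\tau(a)=\tau(b)=0\}$. $\theta$ is stationary if $\frac{d}{d\epsilon}\mathcal E[\theta+\epsilon\tau]|_{\epsilon=0}=0$ for all $\tau\in\mathcal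 C^D([a,b])$; equivalently, $\theta$ is a $C^2$ solution of $\theta''(s)+V_\theta(\theta(s))=0$ on $[a,b]$ with $\theta(a)=T_a$, $\theta(b)=T_b$. $\theta$ is locally minimal for $\mathcal E$ on a set $\mathcal P$ of perturbations if for every $\tau\in\mathcal P$ there exists $M>0$ such that $\mathcal E[\theta+\epsilon\tau]>\mathcal E[\theta]$ for all $\epsilon\in[-M,M]\setminus\{0\}$. Pseudo-energy and length: the quantity $E_0=\frac{\theta'(s)^2}{2}+V(\theta(s))$ is independent of $s$ and is called the pseudo-energy of $\theta$. With $c$ the unique zero of $\theta'$, set $\theta_c=\theta(c)$; then $V(\theta_c)=E_0$ and $V_\theta(\theta_c)\neq0$, so for $E$ near $E_0$ there is a unique $T(E)$ near $\theta_c$ with $V(T(E))=E$ and $T(E_0)=\theta_c$. The length (flight time from $\theta(a)$ to the turning point $T(E)$ and back to $\theta(b)$ along a solution of pseudo-energy $E$) is $$L(E)=\frac1{\sqrt2}\left|\int_{\theta(a)}^{T(E)}\frac{d\vartheta}{\sqrt{E-V(\vartheta)}}\right|+\frac1{\sqrt2}\left|\int_{\theta(b)}^{T(E)}\frac{d\vartheta}{\sqrt{E-V(\vartheta)}}\right|,$$ where $\theta(a),\theta(b)$ are kept fixed as $E$ varies. *)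

theory Defs
  imports "HOL-Analysis.Analysis"
begin

text \<open>
  Functions on \<open>[a,b]\<close> are total functions \<open>real \<Rightarrow> real\<close> of which only the values on \<open>{a..b}\<close>
  matter. Derivatives are taken within \<open>{a..b}\<close>, hence are one-sided at the endpoints.
\<close>

definition deriv_on :: "real set \<Rightarrow> (real \<Rightarrow> real) \<Rightarrow> real \<Rightarrow> real" where
  "deriv_on S f x = vector_derivative f (at x within S)"

definition C1_on :: "real set \<Rightarrow> (real \<Rightarrow> real) \<Rightarrow> bool" where
  "C1_on S f \<longleftrightarrow> (\<forall>x\<in>S. f differentiable (at x within S)) \<and> continuous_on S (deriv_on S f)"

definition C2_on :: "real set \<Rightarrow> (real \<Rightarrow> real) \<Rightarrow> bool" where
  "C2_on S f \<longleftrightarrow> C1_on S f \<and> C1_on S (deriv_on S f)"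

definition energy :: "real \<Rightarrow> real \<Rightarrow> real \<Rightarrow> (real \<Rightarrow> real) \<Rightarrow> (real \<Rightarrow> real) \<Rightarrow> real" where
  "energy a b A V \<theta> =
     integral {a..b} (\<lambda>s. (deriv_on {a..b} \<theta> s - A)\<^sup>2 / 2 - V (\<theta> s))"

definition dirichlet_C1 :: "real \<Rightarrow> real \<Rightarrow> (real \<Rightarrow> real) set" where
  "dirichlet_C1 a b =
     {\<tau>. C1_on {a..b} \<tau> \<and> \<tau> a = 0 \<and> \<tau> b = 0 \<and> (\<exists>s\<in>{a..b}. \<tau> s \<noteq> 0)}"

definition dirichlet_C2 :: "real \<Rightarrow> real \<Rightarrow> (real \<Rightarrow> real) set" where
  "dirichlet_C2 a b =
     {\<tau>. C2_on {a..b} \<tau> \<and> \<tau> a = 0 \<and> \<tau> b = 0 \<and> (\<exists>s\<in>{a..b}. \<tau> s \<noteq> 0)}"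

definition stationary_dirichlet ::
    "real \<Rightarrow> real \<Rightarrow> real \<Rightarrow> (real \<Rightarrow> real) \<Rightarrow> real \<Rightarrow> real \<Rightarrow> (real \<Rightarrow> real) \<Rightarrow> bool" where
  "stationary_dirichlet a b A V Ta Tb \<theta> \<longleftrightarrow>
     C1_on {a..b} \<theta> \<and> \<theta> a = Ta \<and> \<theta> b = Tb \<and>
     (\<forall>\<tau>\<in>dirichlet_C1 a b.
        ((\<lambda>\<epsilon>. energy a b A V (\<lambda>s. \<theta> s + \<epsilon> * \<tau> s)) has_real_derivative 0) (at 0))"

definition locally_minimal ::
    "((real \<Rightarrow> real) \<Rightarrow> real) \<Rightarrow> (real \<Rightarrow> real) set \<Rightarrow> (real \<Rightarrow> real) \<Rightarrow> bool" where
  "locally_minimal J P \<theta> \<longleftrightarrow>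
     (\<forall>\<tau>\<in>P. \<exists>M>0. \<forall>\<epsilon>\<in>{-M..M} - {0}. J (\<lambda>s. \<theta> s + \<epsilon> * \<tau> s) > J \<theta>)"

definition phase_trajectory :: "real \<Rightarrow> real \<Rightarrow> (real \<Rightarrow> real) \<Rightarrow> real \<Rightarrow> real \<times> real" where
  "phase_trajectory a b \<theta> s = (\<theta> s, deriv_on {a..b} \<theta> s)"

text \<open>\<open>card\<close> of an infinite set is 0, so \<open>crossing_index a b \<gamma> = 1\<close> does mean exactly one zero.\<close>

definition crossing_index :: "real \<Rightarrow> real \<Rightarrow> (real \<Rightarrow> real \<times> real) \<Rightarrow> nat" where
  "crossing_index a b \<gamma> = card {s \<in> {a..b}. snd (\<gamma> s) = 0}"

text \<open>Well defined for stationary \<open>\<theta>\<close>, along which the quantity is constant.\<close>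

definition pseudo_energy :: "real \<Rightarrow> real \<Rightarrow> (real \<Rightarrow> real) \<Rightarrow> (real \<Rightarrow> real) \<Rightarrow> real" where
  "pseudo_energy a b V \<theta> =
     (THE E. \<forall>s\<in>{a..b}. (deriv_on {a..b} \<theta> s)\<^sup>2 / 2 + V (\<theta> s) = E)"

text \<open>
  \<open>T\<close> is the local solution \<open>E \<mapsto> T E\<close> of \<open>V (T E) = E\<close> near \<open>\<theta>\<^sub>c\<close> with \<open>T E\<^sub>0 = \<theta>\<^sub>c\<close>. If
  \<open>V \<theta>\<^sub>c = E\<^sub>0\<close> and the derivative of \<open>V\<close> does not vanish at \<open>\<theta>\<^sub>c\<close>, it exists and its germ at
  \<open>E\<^sub>0\<close> is unique; values of \<open>T\<close> away from \<open>E\<^sub>0\<close> are irrelevant.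
\<close>

definition turning_point_branch :: "(real \<Rightarrow> real) \<Rightarrow> real \<Rightarrow> real \<Rightarrow> (real \<Rightarrow> real) \<Rightarrow> bool" where
  "turning_point_branch V E0 \<theta>c T \<longleftrightarrow>
     T E0 = \<theta>c \<and>
     (\<exists>U. open U \<and> \<theta>c \<in> U \<and>
        (\<forall>\<^sub>F E in nhds E0. T E \<in> U \<and> V (T E) = E \<and> (\<forall>x\<in>U. V x = E \<longrightarrow> x = T E)))"

text \<open>
  The integrals are oriented Lebesgue integrals; the endpoint singularity at \<open>T E\<close> is of inverse
  square root type and hence integrable.
\<close>

definition length_fun :: "(real \<Rightarrow> real) \<Rightarrow> real \<Rightarrow> real \<Rightarrow> (real \<Rightarrow> real) \<Rightarrow> real \<Rightarrow> real" where
  "length_fun V \<theta>a \<theta>b T E =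
     1 / sqrt 2 * \<bar>LBINT x=\<theta>a..T E. 1 / sqrt (E - V x)\<bar> +
     1 / sqrt 2 * \<bar>LBINT x=\<theta>b..T E. 1 / sqrt (E - V x)\<bar>"

lemma turning_point_branch_exists:
  assumes V: "C1_on UNIV V" and E0: "V \<theta>c = E0" and nz: "deriv V \<theta>c \<noteq> 0"
  shows "\<exists>T. turning_point_branch V E0 \<theta>c T"
proof -
  have der: "(V has_real_derivative deriv_on UNIV V x) (at x)" for x
    using V unfolding C1_on_def deriv_on_def
    by (metis UNIV_I has_real_derivative_iff_has_vector_derivative vector_derivative_works)
  have c: "continuous_on UNIV (deriv_on UNIV V)" using V by (simp add: C1_on_def)
  have nz': "deriv_on UNIV V \<theta>c \<noteq> 0" using nz DERIV_imp_deriv[OF der] by metis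
  have "open {x. deriv_on UNIV V x \<noteq> 0}" by (rule open_Collect_neq[OF c]) simp
  then obtain d where d: "d > 0" "\<And>x. dist x \<theta>c \<le> d \<Longrightarrow> deriv_on UNIV V x \<noteq> 0"
    using nz' unfolding open_contains_cball by (auto simp: subset_eq dist_commute)
  define U where "U = {\<theta>c - d<..<\<theta>c + d}"
  have cV: "continuous_on S V" for S
    using der by (meson DERIV_isCont continuous_at_imp_continuous_on)
  have inj: "inj_on V {\<theta>c - d..\<theta>c + d}"
  proof (rule linorder_inj_onI)
    fix x y assume xy: "x < y" "x \<in> {\<theta>c - d..\<theta>c + d}" "y \<in> {\<theta>c - d..\<theta>c + d}"
    obtain z where z: "x < z" "z < y" "V y - V x = (y - x) * deriv_on UNIV V z"
      using MVT2[OF xy(1), of V "deriv_on UNIV V"] der by blast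
    have "deriv_on UNIV V z \<noteq> 0" using d(2)[of z] xy z by (auto simp: dist_real_def)
    then show "V x \<noteq> V y" using z xy by auto
  qed auto
  have injU: "inj_on V U" by (rule inj_on_subset[OF inj]) (auto simp: U_def)
  have opV: "open (V ` U)"
    by (rule injective_eq_1d_open_map_UNIV[THEN iffD1, rule_format, of U V])
      (auto simp: U_def cV injU[unfolded U_def] is_interval_oo)
  define T where "T = inv_into U V"
  have cU: "\<theta>c \<in> U" using d by (auto simp: U_def)
  have "\<forall>\<^sub>F E in nhds E0. E \<in> V ` U"
    using opV cU E0 by (intro eventually_nhds_in_open) auto
  then have "\<forall>\<^sub>F E in nhds E0. T E \<in> U \<and> V (T E) = E \<and> (\<forall>x\<in>U. V x = E \<longrightarrow> x = T E)"
    by eventually_elim (auto simp: T_def inv_into_into f_inv_into_f inv_into_f_f injU dest: inj_onD[OF injU])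
  moreover have "T E0 = \<theta>c" using cU E0 injU by (auto simp: T_def)
  moreover have "open U" by (simp add: U_def)
  ultimately show ?thesis using cU unfolding turning_point_branch_def by blast
qed

end

theory Submission imports Defs begin

text \<open>
  Write \<open>w = \<theta>'\<close> and \<open>q = V''(\<theta>)\<close>. Along a direction \<open>\<tau>\<close> that vanishes at both ends, the energy is
  \<open>\<E>[\<theta>] + \<epsilon>\<^sup>2 / 2 \<delta>2 + o(\<epsilon>\<^sup>2)\<close>, where the second variation \<open>\<delta>2\<close> is the integral of \<open>\<tau>'\<^sup>2 - q \<tau>\<^sup>2\<close>
  (\<open>energy_expansion\<close>). So it suffices that \<open>\<delta>2\<close> is positive for all admissible directions if the
  derivative \<open>D\<close> of the length at \<open>E0\<close> is positive, and negative for some direction if \<open>D < 0\<close>.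

  Differentiating the equation of motion shows that \<open>w\<close> solves the Jacobi equation \<open>u'' = - q u\<close>, and \<open>w\<close>
  has the single zero \<open>c\<close>, where \<open>w' = - V'(\<theta> c)\<close> does not vanish. Let \<open>v\<close> be a second solution with
  \<open>w v' - w' v = 1\<close>; there is an explicit formula for it (\<open>jacobi_second_solution\<close>). Then \<open>\<delta>2\<close> is
  controlled by the number \<open>v a / w a - v b / w b\<close>. If it is positive, some combination \<open>v + k w\<close> has no
  zero on \<open>[a, b]\<close>, hence \<open>\<delta>2 > 0\<close> (\<open>second_variation_pos\<close>). If it is negative, the solutions that vanish
  at \<open>a\<close> and at \<open>b\<close>, glued smoothly near \<open>c\<close>, form a direction with \<open>\<delta>2 < 0\<close>
  (\<open>second_variation_neg\<close>).

  It remains to see that \<open>D = v a / w a - v b / w b\<close>. Formally, differentiating the integral of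
  \<open>1 / sqrt (2 (E - V x))\<close> with respect to \<open>E\<close> gives minus the integral of \<open>1 / w\<^sup>2\<close> over time, which is the
  negative of the increment of \<open>v / w\<close>; but both integrals diverge at the turning point. The same
  integration by parts regularizes both sides. For the length, the regularized integral
  (\<open>half_length_formula\<close>) can be differentiated by dominated convergence after the substitution
  \<open>x = \<theta> s\<close> (\<open>half_length_derivative_pos\<close>). The two halves of the orbit and the two possible signs of
  the velocity are related by reflections in time and in space (\<open>length_derivative\<close>).
\<close>

section \<open>Differentiability on a compact interval\<close>

lemma deriv_on_Icc:
  assumes "a < b" "s \<in> {a..b}" "(f has_real_derivative y) (at s within {a..b})"
  shows "deriv_on {a..b} f s = y"
  using assms vector_derivative_within_cbox[of a b s f y]
  by (simp add: deriv_on_def has_real_derivative_iff_has_vector_derivative)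

lemma C1_on_has_derivative:
  assumes "C1_on S f" "s \<in> S"
  shows "(f has_real_derivative deriv_on S f s) (at s within S)"
  using assms unfolding C1_on_def deriv_on_def has_real_derivative_iff_has_vector_derivative
  using vector_derivative_works by blast

lemma C1_on_continuous: "C1_on S f \<Longrightarrow> continuous_on S f"
  by (metis C1_on_has_derivative DERIV_continuous continuous_on_eq_continuous_within)

lemma continuous_on_compact_bound:
  fixes f :: "'a::topological_space \<Rightarrow> real"
  assumes "compact S" "continuous_on S f"
  obtains B where "B > 0" "\<And>s. s \<in> S \<Longrightarrow> \<bar>f s\<bar> \<le> B"
proof -
  obtain B where "\<And>s. s \<in> S \<Longrightarrow> \<bar>f s\<bar> \<le> B"
    using compact_imp_bounded[OF compact_continuous_image[OF assms(2,1)]] unfolding bounded_iff by auto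
  then show thesis using that[of "\<bar>B\<bar> + 1"] by force
qed

lemma C1_on_IccI:
  assumes "a < b" "\<And>s. s \<in> {a..b} \<Longrightarrow> (f has_real_derivative f' s) (at s within {a..b})"
    "continuous_on {a..b} f'"
  shows "C1_on {a..b} f"
proof -
  have "continuous_on {a..b} (deriv_on {a..b} f)"
    using assms(3) by (rule continuous_on_eq) (use deriv_on_Icc assms(1,2) in metis)
  then show ?thesis
    using assms(2) unfolding C1_on_def real_differentiable_def by blast
qed

lemma C2_on_IccI:
  assumes "a < b" "\<And>s. s \<in> {a..b} \<Longrightarrow> (f has_real_derivative f' s) (at s within {a..b})"
    "\<And>s. s \<in> {a..b} \<Longrightarrow> (f' has_real_derivative f'' s) (at s within {a..b})"
    "continuous_on {a..b} f''"
  shows "C2_on {a..b} f"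
proof -
  have eq: "deriv_on {a..b} f s = f' s" if "s \<in> {a..b}" for s
    using deriv_on_Icc assms(1,2) that by metis
  have "continuous_on {a..b} f'"
    using assms(3) by (metis DERIV_continuous continuous_on_eq_continuous_within)
  then have "C1_on {a..b} f" using C1_on_IccI assms(1,2) by blast
  moreover have "C1_on {a..b} (deriv_on {a..b} f)"
  proof (rule C1_on_IccI[OF assms(1) _ assms(4)])
    fix s assume s: "s \<in> {a..b}"
    show "(deriv_on {a..b} f has_real_derivative f'' s) (at s within {a..b})"
      using has_field_derivative_transform_within[OF assms(3)[OF s] zero_less_one s] eq by auto
  qed
  ultimately show ?thesis by (simp add: C2_on_def)
qed

lemma C2_on_UNIV_derivatives:
  assumes "C2_on UNIV V"
  shows "(V has_real_derivative deriv V x) (at x)"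
    and "(deriv V has_real_derivative deriv (deriv V) x) (at x)"
    and "continuous_on UNIV (deriv (deriv V))"
proof -
  have 1: "(V has_real_derivative deriv_on UNIV V x) (at x)" for x
    using assms C1_on_has_derivative by (metis C2_on_def UNIV_I)
  then have eq: "deriv_on UNIV V = deriv V" by (metis DERIV_imp_deriv ext)
  show "(V has_real_derivative deriv V x) (at x)" using 1 eq by metis
  have 2: "(deriv V has_real_derivative deriv_on UNIV (deriv V) x) (at x)" for x
    using assms C1_on_has_derivative eq by (metis C2_on_def UNIV_I)
  then have eq2: "deriv_on UNIV (deriv V) = deriv (deriv V)" by (metis DERIV_imp_deriv ext)
  show "(deriv V has_real_derivative deriv (deriv V) x) (at x)" using 2 eq2 by metis
  show "continuous_on UNIV (deriv (deriv V))"
    using assms eq eq2 by (simp add: C2_on_def C1_on_def)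
qed

section \<open>Expansion of the energy and the Euler--Lagrange equation\<close>

text \<open>
  For a \<open>C\<^sup>2\<close> function the second-order Taylor remainder is \<open>o(h\<^sup>2)\<close> uniformly for base points in
  a compact set. Since \<open>V\<close> is only \<open>C\<^sup>2\<close>, this is the best error available for the energy below.
\<close>

lemma taylor2_uniform:
  fixes V V1 V2 :: "real \<Rightarrow> real"
  assumes V: "\<And>x. (V has_real_derivative V1 x) (at x)"
    and V1: "\<And>x. (V1 has_real_derivative V2 x) (at x)"
    and V2: "continuous_on UNIV V2" and "\<eta> > 0"
  shows "\<exists>d>0. \<forall>x h. \<bar>x\<bar> \<le> N \<longrightarrow> \<bar>h\<bar> \<le> d \<longrightarrow>
           \<bar>V (x + h) - V x - V1 x * h - V2 x * h\<^sup>2 / 2\<bar> \<le> \<eta> * h\<^sup>2"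
proof -
  have "uniformly_continuous_on {-(N+1)..N+1} V2"
    by (rule compact_uniformly_continuous) (auto intro: continuous_on_subset[OF V2])
  then obtain d where d: "d > 0"
    "\<And>x y. x \<in> {-(N+1)..N+1} \<Longrightarrow> y \<in> {-(N+1)..N+1} \<Longrightarrow> dist y x < d \<Longrightarrow> dist (V2 y) (V2 x) < \<eta>"
    using \<open>\<eta> > 0\<close> unfolding uniformly_continuous_on_def by metis
  show ?thesis
  proof (intro exI[of _ "min 1 (d/2)"] conjI allI impI)
    show "0 < min 1 (d/2)" using d by simp
    fix x h :: real assume x: "\<bar>x\<bar> \<le> N" and h: "\<bar>h\<bar> \<le> min 1 (d/2)"
    define df where "df m t = (if m = 0 then V (x+t) else if m = 1 then V1 (x+t) else V2 (x+t))"
      for m :: nat and t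
    have "\<exists>t. \<bar>t\<bar> \<le> \<bar>h\<bar> \<and> V (x+h) = (\<Sum>m<2. df m 0 / fact m * h ^ m) + df 2 t / fact 2 * h ^ 2"
    proof (rule Maclaurin_bi_le)
      show "df 0 = (\<lambda>h. V (x+h))" by (auto simp: df_def)
      have "((\<lambda>t. V (x+t)) has_real_derivative V1 (x+t)) (at t)"
        "((\<lambda>t. V1 (x+t)) has_real_derivative V2 (x+t)) (at t)" for t
        using DERIV_shift[of V "V1 (x+t)" t x] DERIV_shift[of V1 "V2 (x+t)" t x] V V1
        by (simp_all add: add.commute)
      then show "\<forall>m t. m < 2 \<and> \<bar>t\<bar> \<le> \<bar>h\<bar> \<longrightarrow> (df m has_real_derivative df (Suc m) t) (at t)"
        by (auto simp: df_def[abs_def] less_2_cases_iff)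
    qed
    then obtain t where t: "\<bar>t\<bar> \<le> \<bar>h\<bar>" "V (x+h) = V x + V1 x * h + V2 (x+t) * h\<^sup>2 / 2"
      by (auto simp: df_def numeral_2_eq_2)
    have "dist (V2 (x+t)) (V2 x) < \<eta>"
      using d x h t by (intro d(2)) (auto simp: dist_real_def)
    then have "\<bar>V2 (x+t) - V2 x\<bar> * (h\<^sup>2/2) \<le> \<eta> * h\<^sup>2"
      using \<open>\<eta> > 0\<close> by (intro mult_mono) (auto simp: dist_real_def)
    moreover have "\<bar>V (x + h) - V x - V1 x * h - V2 x * h\<^sup>2 / 2\<bar> = \<bar>V2 (x+t) - V2 x\<bar> * (h\<^sup>2/2)"
    proof -
      have "V (x + h) - V x - V1 x * h - V2 x * h\<^sup>2 / 2 = (V2 (x+t) - V2 x) * (h\<^sup>2/2)"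
        unfolding t by (simp add: algebra_simps diff_divide_distrib)
      then show ?thesis by (simp only: abs_mult) simp
    qed
    ultimately show "\<bar>V (x + h) - V x - V1 x * h - V2 x * h\<^sup>2 / 2\<bar> \<le> \<eta> * h\<^sup>2" by simp
  qed
qed

text \<open>
  \<open>\<delta>1\<close> and \<open>\<delta>2\<close> are the first and second variation of the energy in the direction \<open>\<tau>\<close>. The
  kinetic part is exactly quadratic in \<open>\<epsilon>\<close>, so only the potential contributes to the remainder.
\<close>

lemma energy_expansion:
  fixes V V1 V2 :: "real \<Rightarrow> real" and A :: real
  assumes V: "\<And>x. (V has_real_derivative V1 x) (at x)"
    and V1: "\<And>x. (V1 has_real_derivative V2 x) (at x)"
    and V2: "continuous_on UNIV V2"
    and ab: "a < b" and th: "C1_on {a..b} \<theta>" and ta: "C1_on {a..b} \<tau>" and "\<eta> > 0"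
  defines "\<delta>1 \<equiv> integral {a..b} (\<lambda>s. (deriv_on {a..b} \<theta> s - A) * deriv_on {a..b} \<tau> s - V1 (\<theta> s) * \<tau> s)"
    and "\<delta>2 \<equiv> integral {a..b} (\<lambda>s. (deriv_on {a..b} \<tau> s)\<^sup>2 - V2 (\<theta> s) * (\<tau> s)\<^sup>2)"
  shows "\<exists>d>0. \<forall>\<epsilon>. \<bar>\<epsilon>\<bar> \<le> d \<longrightarrow>
    \<bar>energy a b A V (\<lambda>s. \<theta> s + \<epsilon> * \<tau> s) - energy a b A V \<theta> - \<epsilon> * \<delta>1 - \<epsilon>\<^sup>2 / 2 * \<delta>2\<bar> \<le> \<eta> * \<epsilon>\<^sup>2"
proof -
  define w t where "w = deriv_on {a..b} \<theta>" and "t = deriv_on {a..b} \<tau>"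
  have cw: "continuous_on {a..b} w" "continuous_on {a..b} t"
    using th ta by (auto simp: C1_on_def w_def t_def)
  have c\<theta>: "continuous_on {a..b} \<theta>" "continuous_on {a..b} \<tau>"
    using th ta by (auto intro: C1_on_continuous)
  have cV: "continuous_on S V" "continuous_on S V1" "continuous_on S V2" for S
    using V V1 V2 by (auto intro: continuous_at_imp_continuous_on DERIV_isCont continuous_on_subset)
  have comp: "continuous_on {a..b} (\<lambda>s. V (f s))" "continuous_on {a..b} (\<lambda>s. V1 (f s))"
    "continuous_on {a..b} (\<lambda>s. V2 (f s))" if "continuous_on {a..b} f" for f
    using continuous_on_compose2[OF cV(1)[of UNIV] that] continuous_on_compose2[OF cV(2)[of UNIV] that]
      continuous_on_compose2[OF cV(3)[of UNIV] that] by auto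
  obtain N where N: "\<And>s. s \<in> {a..b} \<Longrightarrow> \<bar>\<theta> s\<bar> \<le> N"
    using continuous_on_compact_bound[OF compact_Icc c\<theta>(1)] by metis
  obtain M where M: "M > 0" "\<And>s. s \<in> {a..b} \<Longrightarrow> \<bar>\<tau> s\<bar> \<le> M"
    using continuous_on_compact_bound[OF compact_Icc c\<theta>(2)] by metis
  define \<eta>' where "\<eta>' = \<eta> / (M\<^sup>2 * (b - a))"
  have \<eta>': "\<eta>' > 0" using \<open>\<eta> > 0\<close> M ab by (simp add: \<eta>'_def)
  obtain d where d: "d > 0"
    "\<And>x h. \<bar>x\<bar> \<le> N \<Longrightarrow> \<bar>h\<bar> \<le> d \<Longrightarrow> \<bar>V (x + h) - V x - V1 x * h - V2 x * h\<^sup>2 / 2\<bar> \<le> \<eta>' * h\<^sup>2"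
    using taylor2_uniform[OF V V1 V2 \<eta>'] by metis
  show ?thesis
  proof (intro exI[of _ "d / M"] conjI allI impI)
    show "0 < d / M" using d M by simp
    fix \<epsilon> assume e: "\<bar>\<epsilon>\<bar> \<le> d / M"
    have der: "deriv_on {a..b} (\<lambda>s. \<theta> s + \<epsilon> * \<tau> s) s = w s + \<epsilon> * t s" if "s \<in> {a..b}" for s
      unfolding w_def t_def
      by (rule deriv_on_Icc[OF ab that])
        (intro DERIV_add DERIV_cmult C1_on_has_derivative[OF th that] C1_on_has_derivative[OF ta that])
    have E: "energy a b A V (\<lambda>s. \<theta> s + \<epsilon> * \<tau> s)
       = integral {a..b} (\<lambda>s. (w s + \<epsilon> * t s - A)\<^sup>2 / 2 - V (\<theta> s + \<epsilon> * \<tau> s))"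
      unfolding energy_def by (rule integral_cong) (simp add: der)
    let ?r = "\<lambda>s. V (\<theta> s + \<epsilon> * \<tau> s) - V (\<theta> s) - V1 (\<theta> s) * (\<epsilon> * \<tau> s) - V2 (\<theta> s) * (\<epsilon> * \<tau> s)\<^sup>2 / 2"
    have "((\<lambda>s. ((w s + \<epsilon> * t s - A)\<^sup>2 / 2 - V (\<theta> s + \<epsilon> * \<tau> s)) - ((w s - A)\<^sup>2 / 2 - V (\<theta> s))
         - \<epsilon> * ((w s - A) * t s - V1 (\<theta> s) * \<tau> s) - \<epsilon>\<^sup>2 / 2 * ((t s)\<^sup>2 - V2 (\<theta> s) * (\<tau> s)\<^sup>2))
       has_integral (energy a b A V (\<lambda>s. \<theta> s + \<epsilon> * \<tau> s) - energy a b A V \<theta> - \<epsilon> * \<delta>1 - \<epsilon>\<^sup>2 / 2 * \<delta>2)) {a..b}"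
      unfolding E unfolding energy_def \<delta>1_def \<delta>2_def w_def[symmetric] t_def[symmetric]
      by (intro has_integral_diff has_integral_mult_right integrable_integral integrable_continuous_interval
          continuous_intros comp cw c\<theta>) auto
    also have "(\<lambda>s. ((w s + \<epsilon> * t s - A)\<^sup>2 / 2 - V (\<theta> s + \<epsilon> * \<tau> s)) - ((w s - A)\<^sup>2 / 2 - V (\<theta> s))
         - \<epsilon> * ((w s - A) * t s - V1 (\<theta> s) * \<tau> s) - \<epsilon>\<^sup>2 / 2 * ((t s)\<^sup>2 - V2 (\<theta> s) * (\<tau> s)\<^sup>2)) = (\<lambda>s. - ?r s)"
      by (rule ext) (simp add: field_simps power2_eq_square)
    finally have I: "((\<lambda>s. - ?r s) has_integral (energy a b A V (\<lambda>s. \<theta> s + \<epsilon> * \<tau> s) - energy a b A V \<theta> - \<epsilon> * \<delta>1 - \<epsilon>\<^sup>2 / 2 * \<delta>2)) {a..b}" .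
    have B: "norm (- ?r s) \<le> \<eta>' * \<epsilon>\<^sup>2 * M\<^sup>2" if s: "s \<in> {a..b}" for s
    proof -
      have "\<bar>\<epsilon> * \<tau> s\<bar> \<le> d / M * M" unfolding abs_mult
        by (rule mult_mono) (use e M s d in auto)
      then have "\<bar>\<epsilon> * \<tau> s\<bar> \<le> d" using M by simp
      then have "\<bar>?r s\<bar> \<le> \<eta>' * (\<epsilon> * \<tau> s)\<^sup>2" using d(2) N s by blast
      also have "\<dots> \<le> \<eta>' * (\<epsilon>\<^sup>2 * M\<^sup>2)"
        unfolding power_mult_distrib using abs_le_square_iff[of "\<tau> s" M] M(1) M(2)[OF s] \<eta>'
        by (intro mult_left_mono) auto
      finally show ?thesis by (simp add: mult.assoc)
    qed
    have "norm (energy a b A V (\<lambda>s. \<theta> s + \<epsilon> * \<tau> s) - energy a b A V \<theta> - \<epsilon> * \<delta>1 - \<epsilon>\<^sup>2 / 2 * \<delta>2)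
        \<le> \<eta>' * \<epsilon>\<^sup>2 * M\<^sup>2 * measure lborel {a..b}"
      by (rule has_integral_bound_real[OF _ finite.emptyI I]) (use B \<eta>' in auto)
    also have "\<dots> = \<eta> * \<epsilon>\<^sup>2" using ab M by (simp add: \<eta>'_def)
    finally show "\<bar>energy a b A V (\<lambda>s. \<theta> s + \<epsilon> * \<tau> s) - energy a b A V \<theta> - \<epsilon> * \<delta>1 - \<epsilon>\<^sup>2 / 2 * \<delta>2\<bar> \<le> \<eta> * \<epsilon>\<^sup>2"
      by simp
  qed
qed

lemma energy_first_variation:
  fixes V V1 V2 :: "real \<Rightarrow> real"
  assumes V: "\<And>x. (V has_real_derivative V1 x) (at x)"
    and V1: "\<And>x. (V1 has_real_derivative V2 x) (at x)"
    and V2: "continuous_on UNIV V2"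
    and ab: "a < b" and th: "C1_on {a..b} \<theta>" and ta: "C1_on {a..b} \<tau>"
  shows "((\<lambda>\<epsilon>. energy a b A V (\<lambda>s. \<theta> s + \<epsilon> * \<tau> s)) has_real_derivative
     integral {a..b} (\<lambda>s. (deriv_on {a..b} \<theta> s - A) * deriv_on {a..b} \<tau> s - V1 (\<theta> s) * \<tau> s)) (at 0)"
    (is "(?J has_real_derivative ?\<delta>1) _")
proof -
  let ?\<delta>2 = "integral {a..b} (\<lambda>s. (deriv_on {a..b} \<tau> s)\<^sup>2 - V2 (\<theta> s) * (\<tau> s)\<^sup>2)"
  obtain d where d: "d > 0" "\<And>\<epsilon>. \<bar>\<epsilon>\<bar> \<le> d \<Longrightarrow> \<bar>?J \<epsilon> - ?J 0 - \<epsilon> * ?\<delta>1 - \<epsilon>\<^sup>2 / 2 * ?\<delta>2\<bar> \<le> 1 * \<epsilon>\<^sup>2"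
    using energy_expansion[OF V V1 V2 ab th ta, of 1 A] by auto
  have "((\<lambda>h. (?J (0 + h) - ?J 0) / h - ?\<delta>1) \<longlongrightarrow> 0) (at 0)"
  proof (rule Lim_null_comparison)
    show "((\<lambda>h. (1 + \<bar>?\<delta>2\<bar> / 2) * \<bar>h\<bar>) \<longlongrightarrow> 0) (at 0)" by (auto intro!: tendsto_eq_intros)
    have "\<forall>\<^sub>F h in at 0. \<bar>h\<bar> < d \<and> h \<noteq> (0::real)"
      using d(1) by (auto simp: eventually_at dist_real_def)
    then show "\<forall>\<^sub>F h in at 0. norm ((?J (0 + h) - ?J 0) / h - ?\<delta>1) \<le> (1 + \<bar>?\<delta>2\<bar> / 2) * \<bar>h\<bar>"
    proof eventually_elim
      case (elim h)
      have "\<bar>?J h - ?J 0 - h * ?\<delta>1\<bar> \<le> h\<^sup>2 + \<bar>h\<^sup>2 / 2 * ?\<delta>2\<bar>" using d(2)[of h] elim by linarith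
      also have "\<dots> = (1 + \<bar>?\<delta>2\<bar> / 2) * \<bar>h\<bar> * \<bar>h\<bar>"
        by (simp add: abs_mult algebra_simps power2_eq_square)
      finally have "\<bar>?J h - ?J 0 - h * ?\<delta>1\<bar> / \<bar>h\<bar> \<le> (1 + \<bar>?\<delta>2\<bar> / 2) * \<bar>h\<bar>"
        using elim by (simp add: divide_le_eq)
      moreover have "(?J (0 + h) - ?J 0) / h - ?\<delta>1 = (?J h - ?J 0 - h * ?\<delta>1) / h"
        using elim by (simp add: field_simps)
      ultimately show ?case by simp
    qed
  qed
  then show ?thesis unfolding DERIV_def by (rule LIM_zero_cancel)
qed

lemma integral_square_eq_0:
  fixes f :: "real \<Rightarrow> real"
  assumes "a < b" "continuous_on {a..b} f" "integral {a..b} (\<lambda>s. (f s)\<^sup>2) = 0" "s \<in> {a..b}"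
  shows "f s = 0"
  using integral_eq_0_iff[of a b "\<lambda>s. (f s)\<^sup>2"] assms continuous_on_power[OF assms(2), of 2] by auto

text \<open>
  The du Bois-Reymond argument: with \<open>F\<close> a primitive of \<open>V'(\<theta>)\<close>, the first variation is the
  integral of \<open>(\<theta>' - A + F) \<tau>'\<close>. Choosing \<open>\<tau>'\<close> to be \<open>\<theta>' - A + F\<close> minus its mean value shows that
  \<open>\<theta>' - A + F\<close> is constant, so \<open>\<theta>'\<close> is differentiable with derivative \<open>- V'(\<theta>)\<close>.
\<close>

lemma stationary_imp_ode:
  fixes V V1 V2 :: "real \<Rightarrow> real"
  assumes V: "\<And>x. (V has_real_derivative V1 x) (at x)"
    and V1: "\<And>x. (V1 has_real_derivative V2 x) (at x)"
    and V2: "continuous_on UNIV V2"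
    and ab: "a < b" and st: "stationary_dirichlet a b A V Ta Tb \<theta>" and s: "s \<in> {a..b}"
  shows "(deriv_on {a..b} \<theta> has_real_derivative - V1 (\<theta> s)) (at s within {a..b})"
proof -
  define w where "w = deriv_on {a..b} \<theta>"
  have th: "C1_on {a..b} \<theta>" using st by (simp add: stationary_dirichlet_def)
  then have cw: "continuous_on {a..b} w" by (auto simp: C1_on_def w_def)
  have cV1: "continuous_on {a..b} (\<lambda>s. V1 (\<theta> s))"
    by (rule continuous_on_compose2[OF _ C1_on_continuous[OF th], of UNIV])
      (use V1 in \<open>auto intro: continuous_at_imp_continuous_on DERIV_isCont\<close>)
  define F where "F s = integral {a..s} (\<lambda>s. V1 (\<theta> s))" for s
  have F: "(F has_real_derivative V1 (\<theta> s)) (at s within {a..b})" if "s \<in> {a..b}" for s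
    unfolding F_def by (rule integral_has_real_derivative[OF cV1 that])
  then have cF: "continuous_on {a..b} F"
    by (metis DERIV_continuous continuous_on_eq_continuous_within)
  define G where "G s = w s - A + F s" for s
  have cG: "continuous_on {a..b} G" unfolding G_def by (intro continuous_intros cw cF)
  \<comment> \<open>Subtracting the mean value makes the test function \<open>\<tau>\<close> vanish at \<open>b\<close> as well.\<close>
  define m where "m = integral {a..b} G / (b - a)"
  define \<tau> where "\<tau> s = integral {a..s} (\<lambda>s. G s - m)" for s
  have t: "(\<tau> has_real_derivative G s - m) (at s within {a..b})" if "s \<in> {a..b}" for s
    unfolding \<tau>_def using that cG by (intro integral_has_real_derivative continuous_intros) auto
  have dt: "deriv_on {a..b} \<tau> s = G s - m" if "s \<in> {a..b}" for s
    using deriv_on_Icc[OF ab that t[OF that]] .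
  have c1t: "C1_on {a..b} \<tau>" by (rule C1_on_IccI[OF ab t]) (auto intro!: continuous_intros cG)
  have t0: "\<tau> a = 0" by (simp add: \<tau>_def)
  have tb: "\<tau> b = 0"
    unfolding \<tau>_def using ab cG by (subst integral_diff) (auto simp: m_def integrable_continuous_interval)
  have "G s - m = 0" if s: "s \<in> {a..b}" for s
  \<comment> \<open>If \<open>\<tau>\<close> vanishes identically it is not an admissible test function, but then \<open>\<tau>' = 0\<close> anyway.\<close>
  proof (cases "\<exists>s\<in>{a..b}. \<tau> s \<noteq> 0")
    case False
    then have "(\<tau> has_real_derivative 0) (at s within {a..b})"
      using has_field_derivative_transform_within[OF DERIV_const zero_less_one s, of 0 \<tau>] by auto
    then show ?thesis using deriv_on_Icc[OF ab s] dt[OF s] by metis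
  next
    case True
    then have "((\<lambda>\<epsilon>. energy a b A V (\<lambda>s. \<theta> s + \<epsilon> * \<tau> s)) has_real_derivative 0) (at 0)"
      using st c1t t0 tb by (auto simp: stationary_dirichlet_def dirichlet_C1_def)
    then have "integral {a..b} (\<lambda>s. (w s - A) * deriv_on {a..b} \<tau> s - V1 (\<theta> s) * \<tau> s) = 0"
      using energy_first_variation[OF V V1 V2 ab th c1t] DERIV_unique unfolding w_def by blast
    moreover have "integral {a..b} (\<lambda>s. (w s - A) * deriv_on {a..b} \<tau> s - V1 (\<theta> s) * \<tau> s)
        = integral {a..b} (\<lambda>s. (w s - A) * (G s - m) - V1 (\<theta> s) * \<tau> s)"
      by (rule integral_cong) (simp add: dt)
    moreover have "(\<lambda>s. (w s - A) * (G s - m) - V1 (\<theta> s) * \<tau> s) integrable_on {a..b}"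
      by (intro integrable_continuous_interval continuous_intros cw cG cV1 C1_on_continuous[OF c1t])
    ultimately have 1: "((\<lambda>s. (w s - A) * (G s - m) - V1 (\<theta> s) * \<tau> s) has_integral 0) {a..b}"
      by (simp add: has_integral_integrable_integral)
    have 2: "((\<lambda>s. F s * (G s - m) + V1 (\<theta> s) * \<tau> s) has_integral (F b * \<tau> b - F a * \<tau> a)) {a..b}"
      using ab by (intro fundamental_theorem_of_calculus)
        (auto simp flip: has_real_derivative_iff_has_vector_derivative intro!: derivative_eq_intros F t)
    have 3: "((\<lambda>s. m * (G s - m)) has_integral m * (\<tau> b - \<tau> a)) {a..b}"
      using ab by (intro has_integral_mult_right fundamental_theorem_of_calculus)
        (auto simp flip: has_real_derivative_iff_has_vector_derivative intro!: derivative_eq_intros t)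
    have "((\<lambda>s. (G s - m)\<^sup>2) has_integral 0) {a..b}"
      using has_integral_diff[OF has_integral_add[OF 1 2] 3] t0 tb
      by (simp add: G_def power2_eq_square algebra_simps)
    then have "integral {a..b} (\<lambda>s. (G s - m)\<^sup>2) = 0" by (rule integral_unique)
    moreover have "continuous_on {a..b} (\<lambda>s. G s - m)" by (intro continuous_intros cG)
    ultimately show ?thesis using integral_square_eq_0[OF ab] s by blast
  qed
  then have weq: "w s = m + A - F s" if "s \<in> {a..b}" for s using that by (force simp: G_def)
  have "((\<lambda>s. m + A - F s) has_real_derivative - V1 (\<theta> s)) (at s within {a..b})"
    by (auto intro!: derivative_eq_intros F s)
  then have "(w has_real_derivative - V1 (\<theta> s)) (at s within {a..b})"
    by (rule has_field_derivative_transform_within[OF _ zero_less_one s]) (use weq in auto)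
  then show ?thesis by (simp add: w_def)
qed

section \<open>The Jacobi equation and the sign of the second variation\<close>

text \<open>
  The density that remains of \<open>1 / w\<^sup>2\<close> after the derivative of \<open>- w' / (w (w\<^sup>2 + w'\<^sup>2))\<close> is split off,
  where \<open>w'' = - q w\<close> and \<open>p = w'\<close>. Unlike \<open>1 / w\<^sup>2\<close> it is continuous across the zeros of \<open>w\<close>,
  provided that \<open>w\<close> and \<open>w'\<close> have no common zero.
\<close>

definition jacobi_kernel :: "real \<Rightarrow> real \<Rightarrow> real \<Rightarrow> real" where
  "jacobi_kernel q w p = (1 - q) * (w\<^sup>2 - p\<^sup>2) / (w\<^sup>2 + p\<^sup>2)\<^sup>2"

text \<open>
  Given one solution \<open>w\<close> of the Jacobi equation \<open>u'' = - q u\<close>, reduction of order gives the second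
  solution \<open>w \<integral> 1 / w\<^sup>2\<close>, which is singular where \<open>w\<close> vanishes. Replacing the integral by its
  regularized form \<open>- p / (w R) + K\<close>, with \<open>R = w\<^sup>2 + p\<^sup>2\<close> and \<open>K\<close> a primitive of the kernel above, gives
  the solution \<open>v = - p / R + w K\<close> on the whole interval, with Wronskian \<open>1\<close>. The difference of
  \<open>v / w\<close> at the two endpoints is minus the regularized integral of \<open>1 / w\<^sup>2\<close> over \<open>[a, b]\<close>.
\<close>

lemma jacobi_second_solution:
  fixes w p q :: "real \<Rightarrow> real"
  assumes ab: "a < b"
    and w: "\<And>s. s \<in> {a..b} \<Longrightarrow> (w has_real_derivative p s) (at s within {a..b})"
    and p: "\<And>s. s \<in> {a..b} \<Longrightarrow> (p has_real_derivative - q s * w s) (at s within {a..b})"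
    and q: "continuous_on {a..b} q"
    and R: "\<And>s. s \<in> {a..b} \<Longrightarrow> (w s)\<^sup>2 + (p s)\<^sup>2 > 0"
  obtains v y where
    "\<And>s. s \<in> {a..b} \<Longrightarrow> (v has_real_derivative y s) (at s within {a..b})"
    "\<And>s. s \<in> {a..b} \<Longrightarrow> (y has_real_derivative - q s * v s) (at s within {a..b})"
    "\<And>s. s \<in> {a..b} \<Longrightarrow> w s * y s - p s * v s = 1"
    "w a \<noteq> 0 \<Longrightarrow> w b \<noteq> 0 \<Longrightarrow> v a / w a - v b / w b =
       p b / (w b * ((w b)\<^sup>2 + (p b)\<^sup>2)) - p a / (w a * ((w a)\<^sup>2 + (p a)\<^sup>2))
       - integral {a..b} (\<lambda>s. jacobi_kernel (q s) (w s) (p s))"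
proof -
  define R where "R s = (w s)\<^sup>2 + (p s)\<^sup>2" for s
  define k where "k s = jacobi_kernel (q s) (w s) (p s)" for s
  define K where "K s = integral {a..s} k" for s
  have cw: "continuous_on {a..b} w" "continuous_on {a..b} p"
    using w p by (metis DERIV_continuous continuous_on_eq_continuous_within)+
  have R0: "R s > 0" if "s \<in> {a..b}" for s using R that by (auto simp: R_def)
  have ck: "continuous_on {a..b} k"
    unfolding k_def jacobi_kernel_def using R by (intro continuous_intros cw q) force
  have K: "(K has_real_derivative k s) (at s within {a..b})" if "s \<in> {a..b}" for s
    unfolding K_def by (rule integral_has_real_derivative[OF ck that])
  have dR: "(R has_real_derivative 2 * w s * p s * (1 - q s)) (at s within {a..b})" if "s \<in> {a..b}" for s
    unfolding R_def by (auto intro!: derivative_eq_intros w p that simp: algebra_simps)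
  define v where "v s = - p s / R s + w s * K s" for s
  define y where "y s = w s / R s + p s * K s" for s
  have keq: "k s = (1 - q s) * ((w s)\<^sup>2 - (p s)\<^sup>2) / (R s)\<^sup>2" for s
    by (simp add: k_def jacobi_kernel_def R_def)
  have cancel: "(w s)\<^sup>2 + (p s)\<^sup>2 = R s" for s by (simp add: R_def)
  show thesis
  proof (rule that)
    fix s assume s: "s \<in> {a..b}"
    have nz: "R s \<noteq> 0" using R0[OF s] by simp
    have "(v has_real_derivative ((q s * w s * R s + p s * (2 * w s * p s * (1 - q s))) / (R s * R s)
             + (p s * K s + k s * w s))) (at s within {a..b})"
      unfolding v_def using nz
      by (auto intro!: derivative_eq_intros w p K dR s) (simp only: minus_divide_left, simp)
    also have "(q s * w s * R s + p s * (2 * w s * p s * (1 - q s))) / (R s * R s) + (p s * K s + k s * w s)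
       = (w s * (q s * R s + (1 - q s) * ((w s)\<^sup>2 + (p s)\<^sup>2))) / (R s)\<^sup>2 + p s * K s"
      unfolding keq by (simp add: power2_eq_square add_divide_distrib[symmetric] algebra_simps)
    also have "\<dots> = y s"
      unfolding cancel y_def using nz by (simp add: field_simps power2_eq_square)
    finally show "(v has_real_derivative y s) (at s within {a..b})" .
    have "(y has_real_derivative ((p s * R s - w s * (2 * w s * p s * (1 - q s))) / (R s * R s)
             + (- q s * w s * K s + k s * p s))) (at s within {a..b})"
      unfolding y_def using nz
      by (auto intro!: derivative_eq_intros w p K dR s)
    also have "(p s * R s - w s * (2 * w s * p s * (1 - q s))) / (R s * R s) + (- q s * w s * K s + k s * p s)
       = (p s * (R s - (1 - q s) * ((w s)\<^sup>2 + (p s)\<^sup>2))) / (R s)\<^sup>2 - q s * w s * K s"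
      unfolding keq by (simp add: power2_eq_square add_divide_distrib[symmetric] diff_divide_distrib[symmetric] algebra_simps)
    also have "\<dots> = - q s * v s"
      unfolding cancel v_def using nz by (simp add: field_simps power2_eq_square)
    finally show "(y has_real_derivative - q s * v s) (at s within {a..b})" .
    have "w s * y s - p s * v s = ((w s)\<^sup>2 + (p s)\<^sup>2) / R s"
      unfolding v_def y_def by (simp add: power2_eq_square algebra_simps add_divide_distrib)
    then show "w s * y s - p s * v s = 1" unfolding cancel using nz by simp
  next
    assume nz: "w a \<noteq> 0" "w b \<noteq> 0"
    show "v a / w a - v b / w b =
       p b / (w b * ((w b)\<^sup>2 + (p b)\<^sup>2)) - p a / (w a * ((w a)\<^sup>2 + (p a)\<^sup>2))
       - integral {a..b} (\<lambda>s. jacobi_kernel (q s) (w s) (p s))"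
      using nz R0[of a] R0[of b] ab unfolding cancel k_def[symmetric] v_def K_def[symmetric]
      by (simp add: K_def[of a] field_simps)
  qed
qed

text \<open>
  Away from \<open>c\<close> the quotient \<open>v / w\<close> has derivative \<open>1 / w\<^sup>2\<close>, so it increases on \<open>[a, c)\<close> and on
  \<open>(c, b]\<close>. If \<open>v a / w a > v b / w b\<close>, then a constant \<open>- k\<close> strictly between these numbers is never
  attained by \<open>v / w\<close>, that is, the solution \<open>z = v + k w\<close> has no zero on \<open>[a, b]\<close>; at \<open>c\<close> itself this
  follows from the Wronskian identity. Jacobi's identity
  \<open>\<tau>'\<^sup>2 - q \<tau>\<^sup>2 = (\<tau>' - z' \<tau> / z)\<^sup>2 + (z' \<tau>\<^sup>2 / z)'\<close> then gives positivity.
\<close>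

lemma second_variation_pos:
  fixes w p q v y :: "real \<Rightarrow> real"
  assumes ab: "a < b" and c: "c \<in> {a<..<b}"
    and w: "\<And>s. s \<in> {a..b} \<Longrightarrow> (w has_real_derivative p s) (at s within {a..b})"
    and p: "\<And>s. s \<in> {a..b} \<Longrightarrow> (p has_real_derivative - q s * w s) (at s within {a..b})"
    and q: "continuous_on {a..b} q"
    and v: "\<And>s. s \<in> {a..b} \<Longrightarrow> (v has_real_derivative y s) (at s within {a..b})"
    and y: "\<And>s. s \<in> {a..b} \<Longrightarrow> (y has_real_derivative - q s * v s) (at s within {a..b})"
    and W: "\<And>s. s \<in> {a..b} \<Longrightarrow> w s * y s - p s * v s = 1"
    and wc: "w c = 0" and wnz: "\<And>s. s \<in> {a..b} \<Longrightarrow> s \<noteq> c \<Longrightarrow> w s \<noteq> 0"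
    and D: "v a / w a - v b / w b > 0"
    and t: "\<And>s. s \<in> {a..b} \<Longrightarrow> (\<tau> has_real_derivative t s) (at s within {a..b})"
    and ct: "continuous_on {a..b} t"
    and t0: "\<tau> a = 0" "\<tau> b = 0" "s0 \<in> {a..b}" "\<tau> s0 \<noteq> 0"
  shows "integral {a..b} (\<lambda>s. (t s)\<^sup>2 - q s * (\<tau> s)\<^sup>2) > 0"
proof -
  define k where "k = - (v a / w a + v b / w b) / 2"
  define z where "z s = v s + k * w s" for s
  define x where "x s = y s + k * p s" for s
  have z: "(z has_real_derivative x s) (at s within {a..b})" if "s \<in> {a..b}" for s
    unfolding z_def x_def by (auto intro!: derivative_eq_intros w v that)
  have x: "(x has_real_derivative - q s * z s) (at s within {a..b})" if "s \<in> {a..b}" for s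
    unfolding x_def z_def by (auto intro!: derivative_eq_intros p y that simp: algebra_simps)
  have cont: "continuous_on {a..b} z" "continuous_on {a..b} x" "continuous_on {a..b} \<tau>"
    using z x t by (metis DERIV_continuous continuous_on_eq_continuous_within)+
  have quot: "v s / w s \<le> v r / w r" if "s \<le> r" "{s..r} \<subseteq> {a..b}" "c \<notin> {s..r}" for s r
  proof (rule DERIV_nonneg_imp_increasing_open[OF that(1)])
    have d: "((\<lambda>s. v s / w s) has_real_derivative 1 / (w i)\<^sup>2) (at i within {a..b})" if "i \<in> {s..r}" for i
    proof -
      have i: "i \<in> {a..b}" "w i \<noteq> 0" using that \<open>{s..r} \<subseteq> {a..b}\<close> \<open>c \<notin> {s..r}\<close> wnz by blast+
      have "((\<lambda>s. v s / w s) has_real_derivative (y i * w i - v i * p i) / (w i * w i)) (at i within {a..b})"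
        by (intro DERIV_divide v w i)
      then show ?thesis using W[OF i(1)] by (simp add: power2_eq_square algebra_simps)
    qed
    show "continuous_on {s..r} (\<lambda>s. v s / w s)"
      using continuous_within_subset[OF DERIV_continuous[OF d] that(2)]
      by (simp add: continuous_on_eq_continuous_within)
    fix i assume "s < i" "i < r"
    then have "s \<in> {a..b}" "r \<in> {a..b}" using that(2) by auto
    then have "(at i within {a..b}) = at i" using \<open>s < i\<close> \<open>i < r\<close> by (intro at_within_interior) auto
    then show "\<exists>y. DERIV (\<lambda>s. v s / w s) i :> y \<and> 0 \<le> y"
      using d[of i] \<open>s < i\<close> \<open>i < r\<close> by (intro exI[of _ "1 / (w i)\<^sup>2"]) auto
  qed
  have znz: "z s \<noteq> 0" if s: "s \<in> {a..b}" for s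
  proof (cases "s = c")
    case True
    then show ?thesis using W[OF s] wc by (auto simp: z_def)
  next
    case False
    have "v s / w s + k \<noteq> 0"
    proof (cases "s < c")
      case True
      then have "v a / w a \<le> v s / w s" using s by (intro quot) auto
      then have "v s / w s + k > 0" using D unfolding k_def by argo
      then show ?thesis by simp
    next
      case 2: False
      then have "v s / w s \<le> v b / w b" using s False by (intro quot) auto
      then have "v s / w s + k < 0" using D unfolding k_def by argo
      then show ?thesis by simp
    qed
    moreover have "z s = w s * (v s / w s + k)" using wnz[OF s False] by (simp add: z_def field_simps)
    ultimately show ?thesis using wnz[OF s False] by simp
  qed
  define f where "f s = t s - x s * \<tau> s / z s" for s
  have cf: "continuous_on {a..b} f" unfolding f_def by (intro continuous_intros cont ct) (use znz in auto)
  have "((\<lambda>s. - q s * (\<tau> s)\<^sup>2 + 2 * x s * \<tau> s * t s / z s - (x s)\<^sup>2 * (\<tau> s)\<^sup>2 / (z s)\<^sup>2) has_integral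
      x b * (\<tau> b)\<^sup>2 / z b - x a * (\<tau> a)\<^sup>2 / z a) {a..b}"
  proof (rule fundamental_theorem_of_calculus)
    fix s assume s: "s \<in> {a..b}"
    have "((\<lambda>s. x s * (\<tau> s)\<^sup>2 / z s) has_real_derivative
       ((- q s * z s * (\<tau> s)\<^sup>2 + 2 * \<tau> s * t s * x s) * z s - x s * (\<tau> s)\<^sup>2 * x s) / (z s * z s)) (at s within {a..b})"
      using znz[OF s] by (auto intro!: derivative_eq_intros x z t s)
    also have "((- q s * z s * (\<tau> s)\<^sup>2 + 2 * \<tau> s * t s * x s) * z s - x s * (\<tau> s)\<^sup>2 * x s) / (z s * z s)
       = - q s * (\<tau> s)\<^sup>2 + 2 * x s * \<tau> s * t s / z s - (x s)\<^sup>2 * (\<tau> s)\<^sup>2 / (z s)\<^sup>2"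
      using znz[OF s] by (simp add: divide_simps power2_eq_square)
    finally show "((\<lambda>s. x s * (\<tau> s)\<^sup>2 / z s) has_vector_derivative
       - q s * (\<tau> s)\<^sup>2 + 2 * x s * \<tau> s * t s / z s - (x s)\<^sup>2 * (\<tau> s)\<^sup>2 / (z s)\<^sup>2) (at s within {a..b})"
      by (simp add: has_real_derivative_iff_has_vector_derivative)
  qed (use ab in simp)
  moreover have "((\<lambda>s. (f s)\<^sup>2) has_integral integral {a..b} (\<lambda>s. (f s)\<^sup>2)) {a..b}"
    by (intro integrable_integral integrable_continuous_interval continuous_intros cf)
  ultimately have "((\<lambda>s. (t s)\<^sup>2 - q s * (\<tau> s)\<^sup>2) has_integral integral {a..b} (\<lambda>s. (f s)\<^sup>2)) {a..b}"
    by (rule has_integral_eq_rhs[OF has_integral_eq[rotated, OF has_integral_add]])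
      (auto simp: t0 f_def power2_eq_square algebra_simps)
  then have I: "integral {a..b} (\<lambda>s. (t s)\<^sup>2 - q s * (\<tau> s)\<^sup>2) = integral {a..b} (\<lambda>s. (f s)\<^sup>2)"
    by (rule integral_unique)
  have "integral {a..b} (\<lambda>s. (f s)\<^sup>2) \<noteq> 0"
  proof
    assume 0: "integral {a..b} (\<lambda>s. (f s)\<^sup>2) = 0"
    have "((\<lambda>s. \<tau> s / z s) has_real_derivative 0) (at s within {a..b})" if s: "s \<in> {a..b}" for s
    proof -
      have "((\<lambda>s. \<tau> s / z s) has_real_derivative (t s * z s - \<tau> s * x s) / (z s * z s)) (at s within {a..b})"
        by (intro DERIV_divide t z s znz)
      moreover have "f s = 0" by (rule integral_square_eq_0[OF ab cf 0 s])
      then have "t s * z s - \<tau> s * x s = 0" using znz[OF s] by (simp add: f_def field_simps)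
      ultimately show ?thesis by simp
    qed
    then have "\<exists>C. \<forall>s\<in>{a..b}. \<tau> s / z s = C" by (intro has_field_derivative_zero_constant) auto
    then obtain C where C: "\<And>s. s \<in> {a..b} \<Longrightarrow> \<tau> s / z s = C" by blast
    from C[of a] C[OF t0(3)] show False using t0 ab znz[OF t0(3)] by auto
  qed
  moreover have "integral {a..b} (\<lambda>s. (f s)\<^sup>2) \<ge> 0" by (intro integral_nonneg integrable_continuous_interval continuous_intros cf) auto
  ultimately show ?thesis using I by simp
qed

text \<open>
  A direction that interpolates between the two solutions \<open>v + k a w\<close> and \<open>v + k b w\<close>, which vanish
  at \<open>a\<close> and at \<open>b\<close> respectively. By the Wronskian identity the integrand of the second variation
  is \<open>k' + w\<^sup>2 k'\<^sup>2\<close> plus a total derivative.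
\<close>

lemma second_variation_interpolant:
  fixes w p q v y k k' k'' \<tau> :: "real \<Rightarrow> real"
  assumes ab: "a < b"
    and w: "\<And>s. s \<in> {a..b} \<Longrightarrow> (w has_real_derivative p s) (at s within {a..b})"
    and p: "\<And>s. s \<in> {a..b} \<Longrightarrow> (p has_real_derivative - q s * w s) (at s within {a..b})"
    and q: "continuous_on {a..b} q"
    and v: "\<And>s. s \<in> {a..b} \<Longrightarrow> (v has_real_derivative y s) (at s within {a..b})"
    and y: "\<And>s. s \<in> {a..b} \<Longrightarrow> (y has_real_derivative - q s * v s) (at s within {a..b})"
    and W: "\<And>s. s \<in> {a..b} \<Longrightarrow> w s * y s - p s * v s = 1"
    and k: "\<And>s. s \<in> {a..b} \<Longrightarrow> (k has_real_derivative k' s) (at s within {a..b})"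
    and k': "\<And>s. s \<in> {a..b} \<Longrightarrow> (k' has_real_derivative k'' s) (at s within {a..b})"
    and k'': "continuous_on {a..b} k''"
    and \<tau>_def: "\<tau> = (\<lambda>s. v s + k s * w s)"
    and t0: "\<tau> a = 0" "\<tau> b = 0"
  shows "C2_on {a..b} \<tau>"
    and "((\<lambda>s. (deriv_on {a..b} \<tau> s)\<^sup>2 - q s * (\<tau> s)\<^sup>2) has_integral
            (k b - k a + integral {a..b} (\<lambda>s. (w s)\<^sup>2 * (k' s)\<^sup>2))) {a..b}"
proof -
  have cont: "continuous_on {a..b} w" "continuous_on {a..b} p" "continuous_on {a..b} v"
    "continuous_on {a..b} y" "continuous_on {a..b} k" "continuous_on {a..b} k'"
    using w p v y k k' by (metis DERIV_continuous continuous_on_eq_continuous_within)+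
  have t: "(\<tau> has_real_derivative y s + k s * p s + k' s * w s) (at s within {a..b})" if "s \<in> {a..b}" for s
    unfolding \<tau>_def by (auto intro!: derivative_eq_intros w v k that)
  have t2: "((\<lambda>s. y s + k s * p s + k' s * w s) has_real_derivative
      - q s * v s - q s * k s * w s + 2 * k' s * p s + k'' s * w s) (at s within {a..b})" if "s \<in> {a..b}" for s
    by (auto intro!: derivative_eq_intros w p y k k' that simp: algebra_simps)
  show "C2_on {a..b} \<tau>" by (rule C2_on_IccI[OF ab t t2]) (auto intro!: continuous_intros cont q k'')
  have dt: "deriv_on {a..b} \<tau> s = y s + k s * p s + k' s * w s" if "s \<in> {a..b}" for s
    using deriv_on_Icc[OF ab that t[OF that]] .
  define \<sigma> where "\<sigma> s = y s + k s * p s" for s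
  have \<sigma>: "(\<sigma> has_real_derivative - q s * \<tau> s + k' s * p s) (at s within {a..b})" if "s \<in> {a..b}" for s
    unfolding \<sigma>_def \<tau>_def by (auto intro!: derivative_eq_intros p y k that simp: algebra_simps)
  have "((\<lambda>s. (y s + k s * p s + k' s * w s) * \<sigma> s + (- q s * \<tau> s + k' s * p s) * \<tau> s + k' s) has_integral
      ((\<tau> b * \<sigma> b + k b) - (\<tau> a * \<sigma> a + k a))) {a..b}"
    using ab by (intro fundamental_theorem_of_calculus)
      (auto simp flip: has_real_derivative_iff_has_vector_derivative intro!: derivative_eq_intros t \<sigma> k)
  moreover have "((\<lambda>s. (w s)\<^sup>2 * (k' s)\<^sup>2) has_integral integral {a..b} (\<lambda>s. (w s)\<^sup>2 * (k' s)\<^sup>2)) {a..b}"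
    by (intro integrable_integral integrable_continuous_interval continuous_intros cont)
  ultimately have I: "((\<lambda>s. (y s + k s * p s + k' s * w s) * \<sigma> s + (- q s * \<tau> s + k' s * p s) * \<tau> s + k' s + (w s)\<^sup>2 * (k' s)\<^sup>2) has_integral
      (((\<tau> b * \<sigma> b + k b) - (\<tau> a * \<sigma> a + k a)) + integral {a..b} (\<lambda>s. (w s)\<^sup>2 * (k' s)\<^sup>2))) {a..b}"
    by (rule has_integral_add)
  have eq: "(y s + k s * p s + k' s * w s) * \<sigma> s + (- q s * \<tau> s + k' s * p s) * \<tau> s + k' s + (w s)\<^sup>2 * (k' s)\<^sup>2
       = (deriv_on {a..b} \<tau> s)\<^sup>2 - q s * (\<tau> s)\<^sup>2" if s: "s \<in> {a..b}" for s
  proof -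
    have "(y s + k s * p s + k' s * w s) * \<sigma> s + (- q s * \<tau> s + k' s * p s) * \<tau> s + k' s + (w s)\<^sup>2 * (k' s)\<^sup>2
       = (y s + k s * p s + k' s * w s)\<^sup>2 - q s * (\<tau> s)\<^sup>2 + k' s * (1 - (w s * y s - p s * v s))"
      by (simp add: \<sigma>_def \<tau>_def power2_eq_square algebra_simps)
    then show ?thesis using W[OF s] dt[OF s] by simp
  qed
  show "((\<lambda>s. (deriv_on {a..b} \<tau> s)\<^sup>2 - q s * (\<tau> s)\<^sup>2) has_integral
            (k b - k a + integral {a..b} (\<lambda>s. (w s)\<^sup>2 * (k' s)\<^sup>2))) {a..b}"
    using has_integral_eq[OF eq I] t0 by (simp add: algebra_simps)
qed

text \<open>
  The interpolation is concentrated near the zero \<open>c\<close> of \<open>w\<close>: for \<open>k\<close> an affine function of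
  \<open>arctan ((s - c) / \<rho>)\<close>, the cost \<open>w\<^sup>2 k'\<^sup>2\<close> has integral of order \<open>\<rho>\<close>, so that the second variation
  tends to \<open>k b - k a = v a / w a - v b / w b\<close> as \<open>\<rho>\<close> tends to \<open>0\<close>.
\<close>

lemma second_variation_neg:
  fixes w p q v y :: "real \<Rightarrow> real"
  assumes ab: "a < b" and c: "c \<in> {a<..<b}"
    and w: "\<And>s. s \<in> {a..b} \<Longrightarrow> (w has_real_derivative p s) (at s within {a..b})"
    and p: "\<And>s. s \<in> {a..b} \<Longrightarrow> (p has_real_derivative - q s * w s) (at s within {a..b})"
    and q: "continuous_on {a..b} q"
    and v: "\<And>s. s \<in> {a..b} \<Longrightarrow> (v has_real_derivative y s) (at s within {a..b})"
    and y: "\<And>s. s \<in> {a..b} \<Longrightarrow> (y has_real_derivative - q s * v s) (at s within {a..b})"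
    and W: "\<And>s. s \<in> {a..b} \<Longrightarrow> w s * y s - p s * v s = 1"
    and wc: "w c = 0" and wab: "w a \<noteq> 0" "w b \<noteq> 0"
    and D: "v a / w a - v b / w b < 0"
  shows "\<exists>\<tau>\<in>dirichlet_C2 a b. integral {a..b} (\<lambda>s. (deriv_on {a..b} \<tau> s)\<^sup>2 - q s * (\<tau> s)\<^sup>2) < 0"
proof -
  define D where "D = v a / w a - v b / w b"
  have D0: "D < 0" using D by (simp add: D_def)
  have cont: "continuous_on {a..b} w" "continuous_on {a..b} p"
    using w p by (metis DERIV_continuous continuous_on_eq_continuous_within)+
  obtain P where P: "\<And>s. s \<in> {a..b} \<Longrightarrow> \<bar>p s\<bar> \<le> P" "P > 0"
    using continuous_on_compact_bound[OF compact_Icc cont(2)] by metis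
  have wlip: "\<bar>w s\<bar> \<le> P * \<bar>s - c\<bar>" if "s \<in> {a..b}" for s
    using field_differentiable_bound[of "{a..b}" w p P s c] w P(1) that c wc by auto
  \<comment> \<open>The first two bounds keep the total increase of the arctangent at least \<open>1\<close>, the third one makes
    the cost of the interpolation at most \<open>\<bar>D\<bar> / 2\<close>.\<close>
  define \<rho> where "\<rho> = min (min (b - c) (c - a)) (1 / (2 * P\<^sup>2 * \<bar>D\<bar>))"
  have \<rho>: "\<rho> > 0" "\<rho> \<le> b - c" "\<rho> \<le> c - a" "P\<^sup>2 * \<bar>D\<bar> * \<rho> \<le> 1/2"
  proof -
    show "\<rho> > 0" using c P D0 by (simp add: \<rho>_def mult_neg_pos)
    show "\<rho> \<le> b - c" "\<rho> \<le> c - a" by (auto simp: \<rho>_def)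
    have "P\<^sup>2 * \<bar>D\<bar> * \<rho> \<le> P\<^sup>2 * \<bar>D\<bar> * (1 / (2 * P\<^sup>2 * \<bar>D\<bar>))"
      by (intro mult_left_mono) (auto simp: \<rho>_def)
    also have "\<dots> = 1/2" using P D0 by simp
    finally show "P\<^sup>2 * \<bar>D\<bar> * \<rho> \<le> 1/2" .
  qed
  define g where "g s = arctan ((s - c) / \<rho>)" for s
  define B where "B = g b - g a"
  have "arctan 1 \<le> g b" unfolding g_def using \<rho> by (intro arctan_monotone') (simp add: le_divide_eq)
  moreover have "g a \<le> arctan (-1)" unfolding g_def using \<rho> by (intro arctan_monotone') (simp add: divide_le_eq)
  ultimately have B: "B \<ge> 1" using pi_ge_two by (simp add: B_def arctan_one arctan_minus)
  define \<beta> where "\<beta> = D / B"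
  define k where "k s = - v a / w a + \<beta> * (g s - g a)" for s
  define k' where "k' s = \<beta> * \<rho> / (\<rho>\<^sup>2 + (s - c)\<^sup>2)" for s
  define k'' where "k'' s = - \<beta> * \<rho> * (2 * (s - c)) / (\<rho>\<^sup>2 + (s - c)\<^sup>2)\<^sup>2" for s
  have pos: "\<rho>\<^sup>2 + (s - c)\<^sup>2 > 0" for s using \<rho> by (simp add: add_pos_nonneg)
  have dk: "(k has_real_derivative k' s) (at s within {a..b})" for s
  proof -
    have "(k has_real_derivative \<beta> * (1 / \<rho> / (1 + ((s - c) / \<rho>)\<^sup>2))) (at s)"
      unfolding k_def g_def using \<rho> by (auto intro!: derivative_eq_intros simp: field_simps)
    also have "\<beta> * (1 / \<rho> / (1 + ((s - c) / \<rho>)\<^sup>2)) = k' s"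
      unfolding k'_def using \<rho> pos[of s] by (simp add: divide_simps power2_eq_square)
    finally show ?thesis by (rule has_field_derivative_at_within)
  qed
  have dk': "(k' has_real_derivative k'' s) (at s within {a..b})" for s
    unfolding k'_def k''_def using pos[of s]
    by (auto intro!: derivative_eq_intros simp: power2_eq_square)
  have ck'': "continuous_on {a..b} k''"
    unfolding k''_def by (intro continuous_intros) (use pos in \<open>metis less_irrefl power_eq_0_iff\<close>)
  have ck': "continuous_on {a..b} k'"
    unfolding k'_def by (intro continuous_intros) (use pos in \<open>metis less_irrefl power_eq_0_iff\<close>)
  have kb: "k b = - v b / w b" unfolding k_def B_def[symmetric] \<beta>_def using B by (simp add: D_def)
  define \<tau> where "\<tau> = (\<lambda>s. v s + k s * w s)"
  have t0: "\<tau> a = 0" "\<tau> b = 0" using wab kb by (simp_all add: \<tau>_def k_def)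
  note T = second_variation_interpolant[OF ab w p q v y W dk dk' ck'' \<tau>_def t0]
  have C2: "C2_on {a..b} \<tau>" by (rule T(1))
  have "((\<lambda>s. (deriv_on {a..b} \<tau> s)\<^sup>2 - q s * (\<tau> s)\<^sup>2) has_integral
      (k b - k a + integral {a..b} (\<lambda>s. (w s)\<^sup>2 * (k' s)\<^sup>2))) {a..b}" by (rule T(2))
  moreover have "k b - k a = D" by (simp add: kb) (simp add: k_def D_def)
  ultimately have I: "integral {a..b} (\<lambda>s. (deriv_on {a..b} \<tau> s)\<^sup>2 - q s * (\<tau> s)\<^sup>2)
       = D + integral {a..b} (\<lambda>s. (w s)\<^sup>2 * (k' s)\<^sup>2)"
    by (simp add: integral_unique)
  have bound: "(w s)\<^sup>2 * (k' s)\<^sup>2 \<le> P\<^sup>2 * \<beta> * \<rho> * k' s" if s: "s \<in> {a..b}" for s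
  proof -
    have "(w s)\<^sup>2 \<le> P\<^sup>2 * (\<rho>\<^sup>2 + (s - c)\<^sup>2)"
    proof -
      have "(w s)\<^sup>2 \<le> (P * \<bar>s - c\<bar>)\<^sup>2" using wlip[OF s] P(2) abs_le_square_iff[of "w s" "P * \<bar>s - c\<bar>"] by (simp add: abs_mult)
      also have "\<dots> \<le> P\<^sup>2 * (\<rho>\<^sup>2 + (s - c)\<^sup>2)" by (simp add: power_mult_distrib algebra_simps)
      finally show ?thesis .
    qed
    then have "(w s)\<^sup>2 * (k' s)\<^sup>2 \<le> P\<^sup>2 * (\<rho>\<^sup>2 + (s - c)\<^sup>2) * (k' s)\<^sup>2" by (rule mult_right_mono) simp
    also have "\<dots> = P\<^sup>2 * ((\<rho>\<^sup>2 + (s - c)\<^sup>2) * k' s) * k' s" by (simp add: power2_eq_square)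
    also have "(\<rho>\<^sup>2 + (s - c)\<^sup>2) * k' s = \<beta> * \<rho>" using pos[of s] by (simp add: k'_def)
    finally show ?thesis by (simp add: mult.assoc)
  qed
  have "(k' has_integral (k b - k a)) {a..b}"
    using ab dk by (intro fundamental_theorem_of_calculus) (auto simp flip: has_real_derivative_iff_has_vector_derivative)
  then have I2: "((\<lambda>s. P\<^sup>2 * \<beta> * \<rho> * k' s) has_integral P\<^sup>2 * \<beta> * \<rho> * D) {a..b}"
    by (intro has_integral_mult_right) (simp add: kb, simp add: k_def D_def)
  have "integral {a..b} (\<lambda>s. (w s)\<^sup>2 * (k' s)\<^sup>2) \<le> P\<^sup>2 * \<beta> * \<rho> * D"
    unfolding integral_unique[OF I2, symmetric] using bound I2
    by (intro integral_le integrable_continuous_interval continuous_intros cont ck') auto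
  also have "\<dots> \<le> \<bar>D\<bar> / 2"
  proof -
    have "\<bar>\<beta>\<bar> \<le> \<bar>D\<bar>" unfolding \<beta>_def using B divide_left_mono[of 1 B "\<bar>D\<bar>"] by (simp add: abs_divide)
    have "P\<^sup>2 * \<beta> * \<rho> * D = (P\<^sup>2 * \<bar>D\<bar> * \<rho>) * \<bar>\<beta>\<bar>"
      using D0 B by (simp add: \<beta>_def abs_divide)
    also have "\<dots> \<le> 1/2 * \<bar>D\<bar>" using \<rho>(4) \<open>\<bar>\<beta>\<bar> \<le> \<bar>D\<bar>\<close> by (intro mult_mono) auto
    finally show ?thesis by simp
  qed
  finally have neg: "integral {a..b} (\<lambda>s. (deriv_on {a..b} \<tau> s)\<^sup>2 - q s * (\<tau> s)\<^sup>2) < 0"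
    using I D0 by simp
  have "\<tau> c \<noteq> 0" using W[of c] c wc by (auto simp: \<tau>_def)
  then have "\<tau> \<in> dirichlet_C2 a b" using C2 t0 c by (auto simp: dirichlet_C2_def intro!: bexI[of _ c])
  then show ?thesis using neg by blast
qed

section \<open>The time of flight to a turning point\<close>

text \<open>
  The weight \<open>1 / r + \<partial>\<^sub>x (V' / r)\<close> for \<open>r = 2 (E - V x) + V'(x)\<^sup>2\<close>, written as a function of \<open>r\<close>, of
  \<open>d = V'(x)\<close> and of \<open>q = V''(x)\<close>. It arises when \<open>1 / P\<close>, for \<open>P = sqrt (2 (E - V x))\<close>, is integrated
  by parts in order to remove the singularity at the turning point:
  \<open>1 / P = - \<partial>\<^sub>x (P V' / r) + P (1 / r + \<partial>\<^sub>x (V' / r))\<close>.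
\<close>

definition regular_weight :: "real \<Rightarrow> real \<Rightarrow> real \<Rightarrow> real" where
  "regular_weight r d q = ((1 + q) * r + 2 * d\<^sup>2 * (1 - q)) / r\<^sup>2"

text \<open>
  The time of flight from \<open>x0\<close> to the turning point \<open>t\<close>, written without a singular integral. The
  fundamental theorem of calculus for nonnegative functions applies although the integrand on the left
  is unbounded at \<open>t\<close>.
\<close>

lemma half_length_formula:
  fixes V V1 V2 :: "real \<Rightarrow> real"
  assumes V: "\<And>x. (V has_real_derivative V1 x) (at x)"
    and V1: "\<And>x. (V1 has_real_derivative V2 x) (at x)"
    and V2: "continuous_on UNIV V2"
    and xt: "x0 < t" and Vt: "V t = E" and V1t: "V1 t \<noteq> 0"
    and below: "\<And>x. x0 \<le> x \<Longrightarrow> x < t \<Longrightarrow> V x < E"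
  shows "1 / sqrt 2 * \<bar>LBINT x=x0..t. 1 / sqrt (E - V x)\<bar> =
     sqrt (2 * (E - V x0)) * V1 x0 / (2 * (E - V x0) + (V1 x0)\<^sup>2) +
     integral {x0..t} (\<lambda>x. sqrt (2 * (E - V x)) * regular_weight (2 * (E - V x) + (V1 x)\<^sup>2) (V1 x) (V2 x))"
proof -
  define P where "P x = sqrt (2 * (E - V x))" for x
  define R where "R x = 2 * (E - V x) + (V1 x)\<^sup>2" for x
  define g where "g x = regular_weight (R x) (V1 x) (V2 x)" for x
  have cV: "continuous_on S V" "continuous_on S V1" "continuous_on S V2" for S
    using V V1 V2 by (auto intro: continuous_at_imp_continuous_on DERIV_isCont continuous_on_subset)
  have le: "V x \<le> E" if "x \<in> {x0..t}" for x
    using below[of x] Vt that by (cases "x = t") auto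
  have R: "R x > 0" if "x \<in> {x0..t}" for x
  proof (cases "x = t")
    case True then show ?thesis using V1t Vt by (simp add: R_def)
  next
    case False then show ?thesis using below[of x] that by (simp add: R_def add_pos_nonneg)
  qed
  then have Rnz: "R x \<noteq> 0" if "x \<in> {x0..t}" for x using that by force
  have cP: "continuous_on {x0..t} P" unfolding P_def by (intro continuous_intros cV)
  have cR: "continuous_on {x0..t} R" unfolding R_def by (intro continuous_intros cV)
  have cPg: "continuous_on {x0..t} (\<lambda>x. P x * g x)"
    unfolding g_def regular_weight_def
    by (intro continuous_intros cV cR cP) (use Rnz in auto)
  define J where "J x = integral {x0..x} (\<lambda>x. P x * g x)" for x
  have dJ: "(J has_real_derivative P x * g x) (at x within {x0..t})" if "x \<in> {x0..t}" for x
    unfolding J_def by (rule integral_has_real_derivative[OF cPg that])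
  define F where "F x = sqrt 2 * (J x - P x * V1 x / R x)" for x
  have cF: "continuous_on {x0..t} F"
    unfolding F_def
    by (intro continuous_intros cV cR cP DERIV_continuous_on[OF dJ]) (use Rnz in auto)
  have dF: "(F has_real_derivative 1 / sqrt (E - V x)) (at x)" if x: "x0 < x" "x < t" for x
  proof -
    have pos: "E - V x > 0" "P x > 0" "R x > 0" using below[of x] R[of x] x by (auto simp: P_def)
    have "(at x within {x0..t}) = at x" using x by (intro at_within_interior) auto
    then have dJ': "(J has_real_derivative P x * g x) (at x)" using dJ[of x] x by simp
    have dP: "(P has_real_derivative - V1 x / P x) (at x)"
      unfolding P_def using pos by (auto intro!: derivative_eq_intros V simp: field_simps real_sqrt_mult)
    have dR: "(R has_real_derivative - 2 * V1 x * (1 - V2 x)) (at x)"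
      unfolding R_def by (auto intro!: derivative_eq_intros V V1 simp: algebra_simps)
    have "(F has_real_derivative sqrt 2 * (P x * g x -
        ((- V1 x / P x * V1 x + V2 x * P x) * R x - P x * V1 x * (- 2 * V1 x * (1 - V2 x))) / (R x * R x))) (at x)"
      unfolding F_def using pos by (intro DERIV_cmult DERIV_diff DERIV_divide DERIV_mult dJ' dP dR V1) auto
    also have "P x * g x - ((- V1 x / P x * V1 x + V2 x * P x) * R x - P x * V1 x * (- 2 * V1 x * (1 - V2 x))) / (R x * R x)
       = ((P x)\<^sup>2 + (V1 x)\<^sup>2) / (P x * R x)"
    proof -
      have id: "u * (((1 + q) * r + 2 * d\<^sup>2 * (1 - q)) / r\<^sup>2) -
          ((- d / u * d + q * u) * r - u * d * (- 2 * d * (1 - q))) / (r * r) = (u\<^sup>2 + d\<^sup>2) / (u * r)"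
        if "u \<noteq> 0" "r \<noteq> 0" for u r d q :: real
        using that by (simp add: field_simps power2_eq_square)
      show ?thesis unfolding g_def regular_weight_def using pos by (intro id) auto
    qed
    also have "(P x)\<^sup>2 + (V1 x)\<^sup>2 = R x" using pos by (simp add: P_def R_def)
    also have "sqrt 2 * (R x / (P x * R x)) = 1 / sqrt (E - V x)"
    proof -
      have "P x = sqrt 2 * sqrt (E - V x)" unfolding P_def by (rule real_sqrt_mult)
      then show ?thesis using pos by simp
    qed
    finally show ?thesis .
  qed
  have "(LBINT x=x0..t. 1 / sqrt (E - V x)) = F t - F x0"
  proof (rule interval_integral_FTC_nonneg)
    show "((F \<circ> real_of_ereal) \<longlongrightarrow> F x0) (at_right (ereal x0))"
      unfolding ereal_tendsto_simps1 using continuous_on_Icc_at_rightD[OF cF xt] .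
    show "((F \<circ> real_of_ereal) \<longlongrightarrow> F t) (at_left (ereal t))"
      unfolding ereal_tendsto_simps1 using continuous_on_Icc_at_leftD[OF cF xt] .
    fix x assume x: "ereal x0 < ereal x" "ereal x < ereal t"
    then show "(F has_real_derivative 1 / sqrt (E - V x)) (at x)" by (intro dF) auto
    have "isCont V x" using V by (rule DERIV_isCont)
    then show "isCont (\<lambda>x. 1 / sqrt (E - V x)) x"
      using below[of x] x by (intro continuous_intros) auto
  qed (use xt below in \<open>auto intro!: AE_I2 less_imp_le\<close>)
  also have "\<dots> = sqrt 2 * (J t + P x0 * V1 x0 / R x0)"
    using Vt by (simp add: F_def J_def P_def algebra_simps)
  finally have eq: "(LBINT x=x0..t. 1 / sqrt (E - V x)) = sqrt 2 * (J t + P x0 * V1 x0 / R x0)" .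
  have "(LBINT x=x0..t. 1 / sqrt (E - V x)) \<ge> 0"
    unfolding interval_lebesgue_integral_def set_lebesgue_integral_def using xt le
    by (auto intro!: integral_nonneg_AE simp: indicator_def less_imp_le)
  then show ?thesis unfolding eq by (simp add: J_def P_def R_def g_def)
qed

text \<open>
  Where \<open>V\<close> is strictly increasing around \<open>xc\<close>, the uniqueness clause in the definition of a branch
  forces it to stay near \<open>xc\<close> for energies near \<open>E0\<close>; continuity need not be assumed.
\<close>

lemma turning_point_branch_near:
  fixes V V1 :: "real \<Rightarrow> real"
  assumes V: "\<And>x. (V has_real_derivative V1 x) (at x)"
    and br: "turning_point_branch V E0 xc T" and Vc: "V xc = E0"
    and mono: "\<And>x. \<bar>x - xc\<bar> \<le> \<eta> \<Longrightarrow> V1 x > 0" and "\<eta> > 0"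
  shows "\<forall>\<^sub>F E in nhds E0. \<bar>T E - xc\<bar> \<le> \<eta> \<and> V (T E) = E"
proof -
  obtain U where U: "open U" "xc \<in> U"
    "\<forall>\<^sub>F E in nhds E0. T E \<in> U \<and> V (T E) = E \<and> (\<forall>x\<in>U. V x = E \<longrightarrow> x = T E)"
    using br by (auto simp: turning_point_branch_def)
  obtain d where d: "d > 0" "cball xc d \<subseteq> U" using U open_contains_cball by blast
  define \<rho> where "\<rho> = min d \<eta>"
  have \<rho>: "\<rho> > 0" "\<rho> \<le> d" "\<rho> \<le> \<eta>" using d \<open>\<eta> > 0\<close> by (auto simp: \<rho>_def)
  have inc: "V x < V y" if "x < y" "\<bar>x - xc\<bar> \<le> \<eta>" "\<bar>y - xc\<bar> \<le> \<eta>" for x y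
  proof (rule DERIV_pos_imp_increasing[OF that(1)])
    fix z assume "x \<le> z" "z \<le> y"
    then have "V1 z > 0" using that by (intro mono) auto
    then show "\<exists>d. (V has_real_derivative d) (at z) \<and> d > 0" using V by blast
  qed
  have "V (xc - \<rho>) < E0" "E0 < V (xc + \<rho>)"
    using inc[of "xc - \<rho>" xc] inc[of xc "xc + \<rho>"] \<rho> Vc by auto
  then have "\<forall>\<^sub>F E in nhds E0. V (xc - \<rho>) < E \<and> E < V (xc + \<rho>)"
    using eventually_nhds_in_open[of "{V (xc - \<rho>)<..<V (xc + \<rho>)}" E0] by auto
  with U(3) show ?thesis
  proof eventually_elim
    case (elim E)
    have "\<exists>x\<ge>xc - \<rho>. x \<le> xc + \<rho> \<and> V x = E"
    proof (rule IVT')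
      show "continuous_on {xc - \<rho>..xc + \<rho>} V"
        using V by (intro continuous_at_imp_continuous_on ballI DERIV_isCont)
    qed (use elim \<rho> in auto)
    then obtain x where "xc - \<rho> \<le> x" "x \<le> xc + \<rho>" and Vx: "V x = E" by blast
    then have x: "\<bar>x - xc\<bar> \<le> \<rho>" "V x = E" by (auto simp: abs_le_iff)
    then have "x \<in> cball xc d" using \<rho> by (simp add: dist_real_def)
    then have "x \<in> U" using d(2) by blast
    then have "x = T E" using elim x by blast
    then show ?case using x \<rho> by auto
  qed
qed

text \<open>
  The derivative at \<open>E0\<close> of the time of flight from \<open>\<theta> a\<close> to the turning point, for an orbit that
  approaches it with positive velocity. In the regularized formula the upper limit \<open>T E\<close> may be replaced by
  \<open>\<theta> c\<close> up to an error of order \<open>\<bar>E - E0\<bar>\<close> to the power \<open>3/2\<close>, if \<open>2 (E - V)\<close> is cut off at \<open>0\<close>. The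
  substitution \<open>x = \<theta> s\<close> turns the remaining integral into one over \<open>[a, c]\<close> whose difference quotients
  in \<open>E\<close> are bounded, because the Jacobian \<open>w\<close> of the substitution cancels the singularity
  \<open>1 / w\<close> of the derivative of the square root; dominated convergence applies.
\<close>

lemma half_length_derivative_pos:
  fixes V V1 V2 \<theta> w T :: "real \<Rightarrow> real"
  assumes V: "\<And>x. (V has_real_derivative V1 x) (at x)"
    and V1: "\<And>x. (V1 has_real_derivative V2 x) (at x)"
    and V2: "continuous_on UNIV V2"
    and ac: "a < c"
    and \<theta>: "\<And>s. s \<in> {a..c} \<Longrightarrow> (\<theta> has_real_derivative w s) (at s within {a..c})"
    and w: "\<And>s. s \<in> {a..c} \<Longrightarrow> (w has_real_derivative - V1 (\<theta> s)) (at s within {a..c})"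
    and wpos: "\<And>s. a \<le> s \<Longrightarrow> s < c \<Longrightarrow> w s > 0" and wc: "w c = 0"
    and E0: "\<And>s. s \<in> {a..c} \<Longrightarrow> (w s)\<^sup>2 / 2 + V (\<theta> s) = E0"
    and V1c: "V1 (\<theta> c) \<noteq> 0"
    and br: "turning_point_branch V E0 (\<theta> c) T"
  shows "((\<lambda>E. 1 / sqrt 2 * \<bar>LBINT x=\<theta> a..T E. 1 / sqrt (E - V x)\<bar>) has_real_derivative
     V1 (\<theta> a) / (w a * ((w a)\<^sup>2 + (V1 (\<theta> a))\<^sup>2))
     - integral {a..c} (\<lambda>s. jacobi_kernel (V2 (\<theta> s)) (w s) (V1 (\<theta> s)))) (at E0)"
proof -
  define x0 xc where "x0 = \<theta> a" and "xc = \<theta> c"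
  define R where "R E x = 2 * (E - V x) + (V1 x)\<^sup>2" for E x
  define g where "g E x = regular_weight (R E x) (V1 x) (V2 x)" for E x
  define g' where "g' E x = - 2 * (1 + V2 x) / (R E x)\<^sup>2 - 8 * (V1 x)\<^sup>2 * (1 - V2 x) / (R E x) ^ 3" for E x
  define P where "P E x = sqrt (max 0 (2 * (E - V x)))" for E x
  have cV: "continuous_on S V" "continuous_on S V1" "continuous_on S V2" for S
    using V V1 V2 by (auto intro: continuous_at_imp_continuous_on DERIV_isCont continuous_on_subset)
  have comp: "continuous_on S (\<lambda>s. V (f s))" "continuous_on S (\<lambda>s. V1 (f s))"
    "continuous_on S (\<lambda>s. V2 (f s))" if "continuous_on S f" for f :: "'z::topological_space \<Rightarrow> real" and S
    using continuous_on_compose2[OF cV(1)[of UNIV] that] continuous_on_compose2[OF cV(2)[of UNIV] that]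
      continuous_on_compose2[OF cV(3)[of UNIV] that] by auto
  have c\<theta>: "continuous_on {a..c} \<theta>" and cw: "continuous_on {a..c} w"
    using DERIV_continuous_on[OF \<theta>] DERIV_continuous_on[OF w] by auto
  have w0: "w s \<ge> 0" if "s \<in> {a..c}" for s
    using wpos[of s] wc that by (cases "s = c") auto
  have w2: "2 * (E0 - V (\<theta> s)) = (w s)\<^sup>2" if "s \<in> {a..c}" for s
    using E0[OF that] by (simp add: field_simps)
  have Vc: "V xc = E0" using E0[of c] ac wc by (simp add: xc_def)
  have \<theta>mono: "\<theta> r < \<theta> s" if "r < s" "r \<in> {a..c}" "s \<in> {a..c}" for r s
  proof (rule DERIV_pos_imp_increasing_open[OF that(1)])
    show "continuous_on {r..s} \<theta>" using c\<theta> by (rule continuous_on_subset) (use that in auto)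
    fix z assume z: "r < z" "z < s"
    have "(at z within {a..c}) = at z" using z that by (intro at_within_interior) auto
    then show "\<exists>d. (\<theta> has_real_derivative d) (at z) \<and> d > 0"
      using \<theta>[of z] wpos[of z] z that by (intro exI[of _ "w z"]) auto
  qed
  have x0c: "x0 < xc" using \<theta>mono[of a c] ac by (simp add: x0_def xc_def)
  have \<theta>range: "\<theta> s \<in> {x0..xc}" if "s \<in> {a..c}" for s
    using \<theta>mono[of a s] \<theta>mono[of s c] that unfolding x0_def xc_def by (cases "s = a"; cases "s = c") auto
  have below: "V x < E0" if x: "x0 \<le> x" "x < xc" for x
  proof -
    have "\<exists>s\<ge>a. s \<le> c \<and> \<theta> s = x"
      using x ac c\<theta> by (intro IVT') (auto simp: x0_def xc_def)
    then obtain s where s: "s \<in> {a..c}" "\<theta> s = x" by auto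
    then have "s < c" using x by (cases "s = c") (auto simp: xc_def)
    then have "0 < (w s)\<^sup>2" using wpos[of s] s by simp
    then show ?thesis using E0[OF s(1)] unfolding s(2) by linarith
  qed
  have V1c0: "V1 xc > 0"
  proof (rule ccontr)
    assume "\<not> V1 xc > 0"
    then have "V1 xc < 0" using V1c by (simp add: xc_def)
    then obtain d where d: "d > 0" "\<And>h. 0 < h \<Longrightarrow> h < d \<Longrightarrow> V xc < V (xc - h)"
      using DERIV_neg_dec_left[OF V[of xc]] by blast
    define h where "h = min (d / 2) (xc - x0)"
    have h: "h > 0" "h < d" "h \<le> xc - x0" using d x0c by (auto simp: h_def)
    then show False using d(2)[of h] below[of "xc - h"] Vc by auto
  qed
  define m where "m = V1 xc / 2"
  have m: "m > 0" using V1c0 by (simp add: m_def)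
  have R0: "R E0 x > 0" if "x \<in> {x0..xc}" for x
  proof (cases "x = xc")
    case True then show ?thesis using V1c0 Vc by (simp add: R_def)
  next
    case False then show ?thesis using below[of x] that by (simp add: R_def add_pos_nonneg)
  qed
  have "(V1 \<longlongrightarrow> V1 xc) (nhds xc)"
    using DERIV_isCont[OF V1] unfolding isCont_def tendsto_at_iff_tendsto_nhds .
  then have "\<forall>\<^sub>F x in nhds xc. m < V1 x"
    by (rule order_tendstoD(1)) (use V1c0 in \<open>simp add: m_def\<close>)
  moreover have "isCont (R E0) xc"
    unfolding R_def by (intro continuous_intros DERIV_isCont[OF V1] DERIV_isCont[OF V])
  then have "(R E0 \<longlongrightarrow> R E0 xc) (nhds xc)"
    unfolding isCont_def tendsto_at_iff_tendsto_nhds .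
  then have "\<forall>\<^sub>F x in nhds xc. 0 < R E0 x"
    by (rule order_tendstoD(1)) (use R0[of xc] x0c in simp)
  ultimately have "\<forall>\<^sub>F x in nhds xc. m < V1 x \<and> 0 < R E0 x" by eventually_elim simp
  then obtain \<eta>0 where \<eta>0: "\<eta>0 > 0" "\<And>x. \<bar>x - xc\<bar> < \<eta>0 \<Longrightarrow> m < V1 x \<and> 0 < R E0 x"
    unfolding eventually_nhds_metric dist_real_def by blast
  \<comment> \<open>On \<open>[xc - \<eta>, xc + \<eta>]\<close> the potential is increasing, and on \<open>[x0, X]\<close> the denominator is positive.\<close>
  define \<eta> where "\<eta> = min (\<eta>0 / 2) ((xc - x0) / 2)"
  have \<eta>: "\<eta> > 0" "x0 < xc - \<eta>" using \<eta>0(1) x0c by (auto simp: \<eta>_def min_def field_simps)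
  have near: "m < V1 x" "0 < R E0 x" if "\<bar>x - xc\<bar> \<le> \<eta>" for x
    using \<eta>0(2)[of x] that \<eta>0(1) by (auto simp: \<eta>_def)
  have inc: "m * (y - x) \<le> V y - V x" if xy: "x < y" "\<bar>x - xc\<bar> \<le> \<eta>" "\<bar>y - xc\<bar> \<le> \<eta>" for x y
  proof -
    obtain z where z: "x < z" "z < y" "V y - V x = (y - x) * V1 z"
      using MVT2[OF xy(1), of V V1] V by blast
    have "m < V1 z" using z xy by (intro near) auto
    then show ?thesis unfolding z(3) using xy by (subst mult.commute) (intro mult_left_mono, auto)
  qed
  have inc': "V x < V y" if xy: "x < y" "\<bar>x - xc\<bar> \<le> \<eta>" "\<bar>y - xc\<bar> \<le> \<eta>" for x y
    using inc[OF that] mult_pos_pos[OF m, of "y - x"] that by simp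
  define X where "X = xc + \<eta>"
  have R0X: "R E0 x > 0" if "x \<in> {x0..X}" for x
    using R0[of x] near(2)[of x] that \<eta> by (cases "x \<le> xc") (auto simp: X_def)
  obtain r where r: "r > 0" "\<And>x. x \<in> {x0..X} \<Longrightarrow> R E0 x \<ge> 4 * r"
  proof -
    have "continuous_on {x0..X} (R E0)" unfolding R_def by (intro continuous_intros cV)
    then obtain x1 where "x1 \<in> {x0..X}" "\<And>x. x \<in> {x0..X} \<Longrightarrow> R E0 x1 \<le> R E0 x"
      using continuous_attains_inf[of "{x0..X}" "R E0"] x0c \<eta> by (auto simp: X_def)
    then show thesis using that[of "R E0 x1 / 4"] R0X[of x1] by simp
  qed
  have Rr: "R E x \<ge> 2 * r" if "\<bar>E - E0\<bar> \<le> r" "x \<in> {x0..X}" for E x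
    using r(2)[OF that(2)] that(1) by (simp add: R_def)
  then have Rnz: "R E x \<noteq> 0" if "\<bar>E - E0\<bar> \<le> r" "x \<in> {x0..X}" for E x
    using that r(1) by fastforce
  obtain \<mu> where \<mu>: "\<mu> > 0" "\<And>x. x \<in> {x0..xc - \<eta>} \<Longrightarrow> V x \<le> E0 - \<mu>"
  proof -
    obtain x1 where "x1 \<in> {x0..xc - \<eta>}" "\<And>x. x \<in> {x0..xc - \<eta>} \<Longrightarrow> V x \<le> V x1"
      using continuous_attains_sup[of "{x0..xc - \<eta>}" V] cV \<eta> by auto
    then show thesis using that[of "E0 - V x1"] below[of x1] \<eta> by auto
  qed
  \<comment> \<open>The weight \<open>g\<close> and its derivative \<open>g'\<close> in \<open>E\<close> are bounded on a compact rectangle \<open>Z\<close> that contains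
    all energies and positions that matter.\<close>
  define Z where "Z = {E0 - r..E0 + r} \<times> {x0..X}"
  have Z: "\<bar>fst z - E0\<bar> \<le> r \<and> snd z \<in> {x0..X}" if "z \<in> Z" for z
    using that by (auto simp: Z_def)
  have cR: "continuous_on Z (\<lambda>z. R (fst z) (snd z))"
    unfolding R_def by (intro continuous_intros comp)
  have cVZ: "continuous_on Z (\<lambda>z. V1 (snd z))" "continuous_on Z (\<lambda>z. V2 (snd z))"
    by (intro comp continuous_intros)+
  have RZ: "R (fst z) (snd z) \<noteq> 0" if "z \<in> Z" for z
    using Rnz Z[OF that] by blast
  have Zc: "compact Z" unfolding Z_def by (intro compact_Times compact_Icc)
  have "continuous_on Z (\<lambda>z. g (fst z) (snd z))"
    unfolding g_def regular_weight_def by (intro continuous_intros cVZ cR) (use RZ in auto)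
  from continuous_on_compact_bound[OF Zc this] obtain G
    where G: "G > 0" "\<And>z. z \<in> Z \<Longrightarrow> \<bar>g (fst z) (snd z)\<bar> \<le> G" by metis
  have "continuous_on Z (\<lambda>z. g' (fst z) (snd z))"
    unfolding g'_def by (intro continuous_intros cVZ cR) (use RZ in auto)
  from continuous_on_compact_bound[OF Zc this] obtain G'
    where G': "G' > 0" "\<And>z. z \<in> Z \<Longrightarrow> \<bar>g' (fst z) (snd z)\<bar> \<le> G'" by metis
  have gG: "\<bar>g E x\<bar> \<le> G" if "\<bar>E - E0\<bar> \<le> r" "x \<in> {x0..X}" for E x
  proof -
    have "(E, x) \<in> Z" using that by (auto simp: Z_def abs_le_iff)
    then show ?thesis using G(2) by fastforce
  qed
  have dR: "((\<lambda>E. R E x) has_real_derivative 2) (at E within S)" for E x S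
    unfolding R_def by (auto intro!: derivative_eq_intros)
  have dg: "((\<lambda>E. g E x) has_real_derivative g' E x) (at E within S)" if "\<bar>E - E0\<bar> \<le> r" "x \<in> {x0..X}" for E x S
  proof -
    have nz: "R E x \<noteq> 0" using Rnz that by blast
    have "((\<lambda>E. g E x) has_real_derivative
        ((1 + V2 x) * 2 * (R E x)\<^sup>2 - ((1 + V2 x) * R E x + 2 * (V1 x)\<^sup>2 * (1 - V2 x)) * (2 * R E x * 2)) / ((R E x)\<^sup>2 * (R E x)\<^sup>2)) (at E within S)"
      unfolding g_def regular_weight_def using nz
      by (auto intro!: derivative_eq_intros dR)
    also have "((1 + V2 x) * 2 * (R E x)\<^sup>2 - ((1 + V2 x) * R E x + 2 * (V1 x)\<^sup>2 * (1 - V2 x)) * (2 * R E x * 2)) / ((R E x)\<^sup>2 * (R E x)\<^sup>2)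
       = g' E x"
    proof -
      have "((1 + q) * 2 * \<rho>\<^sup>2 - ((1 + q) * \<rho> + 2 * d\<^sup>2 * (1 - q)) * (2 * \<rho> * 2)) / (\<rho>\<^sup>2 * \<rho>\<^sup>2)
          = - 2 * (1 + q) / \<rho>\<^sup>2 - 8 * d\<^sup>2 * (1 - q) / \<rho> ^ 3" if "\<rho> \<noteq> 0" for \<rho> q d :: real
        using that by (simp add: field_simps power2_eq_square power3_eq_cube)
      then show ?thesis using nz unfolding g'_def by blast
    qed
    finally show ?thesis .
  qed
  have gLip: "\<bar>g E x - g E0 x\<bar> \<le> G' * \<bar>E - E0\<bar>" if E: "\<bar>E - E0\<bar> \<le> r" and x: "x \<in> {x0..X}" for E x
  proof -
    have "norm (g E x - g E0 x) \<le> G' * norm (E - E0)"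
    proof (rule field_differentiable_bound[where S = "{E0 - r..E0 + r}" and f' = "\<lambda>E. g' E x"])
      fix e assume e: "e \<in> {E0 - r..E0 + r}"
      show "((\<lambda>E. g E x) has_real_derivative g' e x) (at e within {E0 - r..E0 + r})"
        using e x by (intro dg) auto
      show "norm (g' e x) \<le> G'" using G'(2)[of "(e, x)"] e x by (auto simp: Z_def)
    qed (use E r(1) in auto)
    then show ?thesis by simp
  qed
  have \<theta>X: "\<theta> s \<in> {x0..X}" if "s \<in> {a..c}" for s
    using \<theta>range[OF that] \<eta> by (auto simp: X_def)
  have cg: "continuous_on {x0..X} (g E)" if "\<bar>E - E0\<bar> \<le> r" for E
    unfolding g_def regular_weight_def R_def
    by (intro continuous_intros cV) (use Rnz[OF that] in \<open>auto simp: R_def\<close>)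
  have cP: "continuous_on S (P E)" for S E
    unfolding P_def by (intro continuous_intros cV)
  \<comment> \<open>\<open>N E\<close> is the integral of \<open>P E x * g E x\<close> from \<open>x0\<close> to \<open>xc\<close> after the substitution \<open>x = \<theta> s\<close>.\<close>
  define N where "N E = integral {a..c} (\<lambda>s. P E (\<theta> s) * g E (\<theta> s) * w s)" for E
  have cF: "continuous_on {a..c} (\<lambda>s. P E (\<theta> s) * g E (\<theta> s) * w s)" if "\<bar>E - E0\<bar> \<le> r" for E
    by (intro continuous_intros cw continuous_on_compose2[OF cP[of UNIV] c\<theta>]
        continuous_on_compose2[OF cg[OF that] c\<theta>]) (use \<theta>X in auto)
  have P0: "P E0 (\<theta> s) = w s" if "s \<in> {a..c}" for s
    using w2[OF that] w0[OF that] by (simp add: P_def)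
  define L where "L s = g E0 (\<theta> s) + (w s)\<^sup>2 * g' E0 (\<theta> s)" for s
  obtain W where W: "W > 0" "\<And>s. s \<in> {a..c} \<Longrightarrow> \<bar>w s\<bar> \<le> W"
    using continuous_on_compact_bound[OF compact_Icc cw] by metis
  have dN: "(N has_real_derivative integral {a..c} L) (at E0)"
  proof -
    define Q where "Q h s = (P (E0+h) (\<theta> s) * g (E0+h) (\<theta> s) * w s - P E0 (\<theta> s) * g E0 (\<theta> s) * w s) / h" for h s
    have Qint: "Q h integrable_on {a..c}" "integral {a..c} (Q h) = (N (E0 + h) - N E0) / h" if "\<bar>h\<bar> \<le> r" for h
    proof -
      have "(Q h has_integral (N (E0 + h) - N E0) / h) {a..c}"
        unfolding Q_def N_def using that r(1)
        by (intro has_integral_divide has_integral_diff integrable_integral integrable_continuous_interval cF) auto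
      then show "Q h integrable_on {a..c}" "integral {a..c} (Q h) = (N (E0 + h) - N E0) / h"
        by (auto intro: integral_unique)
    qed
    \<comment> \<open>With \<open>A\<close> the square root at energy \<open>E0 + h\<close>: \<open>\<bar>A - w s\<bar> w s \<le> \<bar>A\<^sup>2 - (w s)\<^sup>2\<bar> \<le> 2 \<bar>h\<bar>\<close>.\<close>
    have bound: "\<bar>Q h s\<bar> \<le> 2 * G + W\<^sup>2 * G'" if h: "\<bar>h\<bar> \<le> r" "h \<noteq> 0" and s: "s \<in> {a..c}" for h s
    proof -
      define A where "A = P (E0+h) (\<theta> s)"
      have A: "A \<ge> 0" "A\<^sup>2 = max 0 ((w s)\<^sup>2 + 2 * h)"
        using w2[OF s] by (auto simp: A_def P_def algebra_simps)
      have "\<bar>A - w s\<bar> * w s \<le> \<bar>A - w s\<bar> * (A + w s)"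
        using A(1) by (intro mult_left_mono) auto
      also have "\<dots> = \<bar>(A - w s) * (A + w s)\<bar>" using A(1) w0[OF s] by (simp add: abs_mult)
      also have "(A - w s) * (A + w s) = A\<^sup>2 - (w s)\<^sup>2" by (simp add: power2_eq_square algebra_simps)
      also have "\<bar>A\<^sup>2 - (w s)\<^sup>2\<bar> \<le> 2 * \<bar>h\<bar>"
        unfolding A(2) using zero_le_power2[of "w s"] by (auto simp: max_def)
      finally have 1: "\<bar>A - w s\<bar> * w s \<le> 2 * \<bar>h\<bar>" .
      have "(\<bar>A - w s\<bar> * w s) * \<bar>g (E0+h) (\<theta> s)\<bar> \<le> (2 * \<bar>h\<bar>) * G"
        by (rule mult_mono[OF 1 gG]) (use h \<theta>X[OF s] in auto)
      moreover have "(w s)\<^sup>2 * \<bar>g (E0+h) (\<theta> s) - g E0 (\<theta> s)\<bar> \<le> W\<^sup>2 * (G' * \<bar>h\<bar>)"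
      proof (rule mult_mono)
        show "(w s)\<^sup>2 \<le> W\<^sup>2" using W(2)[OF s] W(1) abs_le_square_iff[of "w s" W] by simp
      qed (use gLip[of "E0+h" "\<theta> s"] h \<theta>X[OF s] in auto)
      moreover have "\<bar>A * g (E0+h) (\<theta> s) * w s - w s * g E0 (\<theta> s) * w s\<bar>
         \<le> (\<bar>A - w s\<bar> * w s) * \<bar>g (E0+h) (\<theta> s)\<bar> + (w s)\<^sup>2 * \<bar>g (E0+h) (\<theta> s) - g E0 (\<theta> s)\<bar>"
      proof -
        have "A * g (E0+h) (\<theta> s) * w s - w s * g E0 (\<theta> s) * w s
          = (A - w s) * w s * g (E0+h) (\<theta> s) + (w s)\<^sup>2 * (g (E0+h) (\<theta> s) - g E0 (\<theta> s))"
          by (simp add: power2_eq_square algebra_simps)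
        also have "\<bar>\<dots>\<bar> \<le> \<bar>(A - w s) * w s * g (E0+h) (\<theta> s)\<bar> + \<bar>(w s)\<^sup>2 * (g (E0+h) (\<theta> s) - g E0 (\<theta> s))\<bar>"
          by (rule abs_triangle_ineq)
        finally show ?thesis using w0[OF s] by (simp add: abs_mult)
      qed
      ultimately have "\<bar>A * g (E0+h) (\<theta> s) * w s - w s * g E0 (\<theta> s) * w s\<bar> \<le> (2 * G + W\<^sup>2 * G') * \<bar>h\<bar>"
        by (simp add: algebra_simps)
      then show ?thesis
        using h unfolding Q_def P0[OF s] A_def[symmetric] by (simp add: divide_le_eq)
    qed
    have lim: "((\<lambda>h. Q h s) \<longlongrightarrow> (if s = c then 0 else L s)) (at 0)" if s: "s \<in> {a..c}" for s
    proof (cases "s = c")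
      case True
      then show ?thesis using wc by (simp add: Q_def)
    next
      case False
      then have ws: "w s > 0" using wpos[of s] s by simp
      have "((\<lambda>E. max 0 (2 * (E - V (\<theta> s)))) has_real_derivative 2) (at E0)"
      proof (rule has_field_derivative_transform_within_open[of "\<lambda>E. 2 * (E - V (\<theta> s))" _ _ "{V (\<theta> s)<..}"])
        have "0 < (w s)\<^sup>2" using ws by simp
        then have "0 < 2 * (E0 - V (\<theta> s))" unfolding w2[OF s] .
        then show "E0 \<in> {V (\<theta> s)<..}" by simp
      qed (auto intro!: derivative_eq_intros)
      moreover have "max 0 (2 * (E0 - V (\<theta> s))) = (w s)\<^sup>2" using w2[OF s] by simp
      ultimately have "((\<lambda>E. P E (\<theta> s)) has_real_derivative 1 / w s) (at E0)"
        unfolding P_def using ws by (auto intro!: derivative_eq_intros simp: divide_simps)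
      then have "((\<lambda>E. P E (\<theta> s) * g E (\<theta> s) * w s) has_real_derivative
          (1 / w s * g E0 (\<theta> s) + g' E0 (\<theta> s) * P E0 (\<theta> s)) * w s) (at E0)"
        using r(1) \<theta>X[OF s] by (intro DERIV_cmult_right DERIV_mult dg) auto
      also have "(1 / w s * g E0 (\<theta> s) + g' E0 (\<theta> s) * P E0 (\<theta> s)) * w s = L s"
        using ws by (simp add: P0[OF s] L_def power2_eq_square algebra_simps)
      finally show ?thesis using False unfolding DERIV_def Q_def by simp
    qed
    have "((\<lambda>h. (N (E0 + h) - N E0) / h) \<longlongrightarrow> integral {a..c} L) (at 0 within {-r..r})"
      unfolding tendsto_at_iff_sequentially comp_def
    proof (intro allI impI)
      fix H :: "nat \<Rightarrow> real" assume H: "\<forall>i. H i \<in> {- r..r} - {0}" "H \<longlonglongrightarrow> 0"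
      then have H': "\<bar>H i\<bar> \<le> r" "H i \<noteq> 0" for i by (auto simp: abs_le_iff minus_le_iff)
      have "(\<lambda>k. integral {a..c} (Q (H k))) \<longlonglongrightarrow> integral {a..c} (\<lambda>s. if s = c then 0 else L s)"
      proof (rule dominated_convergence(2))
        show "Q (H k) integrable_on {a..c}" for k using Qint H' by blast
        show "(\<lambda>_. 2 * G + W\<^sup>2 * G') integrable_on {a..c}" by (rule integrable_const_ivl)
        show "norm (Q (H k) s) \<le> 2 * G + W\<^sup>2 * G'" if "s \<in> {a..c}" for k s
          using bound[OF H' that] by simp
        show "(\<lambda>k. Q (H k) s) \<longlonglongrightarrow> (if s = c then 0 else L s)" if "s \<in> {a..c}" for s
          using lim[OF that] H H' unfolding tendsto_at_iff_sequentially comp_def by auto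
      qed
      also have "integral {a..c} (\<lambda>s. if s = c then 0 else L s) = integral {a..c} L"
        by (rule integral_spike[of "{c}"]) auto
      also have "(\<lambda>k. integral {a..c} (Q (H k))) = (\<lambda>k. (N (E0 + H k) - N E0) / H k)"
        using Qint H' by blast
      finally show "(\<lambda>k. (N (E0 + H k) - N E0) / H k) \<longlonglongrightarrow> integral {a..c} L" .
    qed
    moreover have "(at 0 within {-r..r}) = at (0::real)" using r(1) by (intro at_within_interior) auto
    ultimately show ?thesis unfolding DERIV_def by simp
  qed
  have Nsub: "N E = integral {x0..xc} (\<lambda>x. P E x * g E x)" if E: "\<bar>E - E0\<bar> \<le> r" for E
  proof -
    have "((\<lambda>s. w s *\<^sub>R (P E (\<theta> s) * g E (\<theta> s))) has_integral integral {\<theta> a..\<theta> c} (\<lambda>x. P E x * g E x)) {a..c}"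
    proof (rule has_integral_substitution[OF _ _ _ _ \<theta>])
      show "\<theta> ` {a..c} \<subseteq> {x0..X}" using \<theta>X by blast
      show "continuous_on {x0..X} (\<lambda>x. P E x * g E x)" by (intro continuous_intros cP cg E)
    qed (use ac x0c in \<open>auto simp: x0_def xc_def\<close>)
    then show ?thesis unfolding N_def x0_def xc_def by (intro integral_unique) (simp add: mult_ac)
  qed
  \<comment> \<open>\<open>I E - N E\<close> vanishes if \<open>T E \<le> xc\<close>; otherwise it is an integral over the short interval \<open>[xc, T E]\<close>,
    whose length is at most \<open>\<bar>E - E0\<bar> / m\<close>.\<close>
  define I where "I E = integral {x0..T E} (\<lambda>x. sqrt (2 * (E - V x)) * g E x)" for E
  have T_near: "\<forall>\<^sub>F E in nhds E0. \<bar>T E - xc\<bar> \<le> \<eta> \<and> V (T E) = E"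
    using turning_point_branch_near[OF V br[folded xc_def] Vc _ \<eta>(1)] near(1) m by fastforce
  have E_near: "\<forall>\<^sub>F E in nhds E0. \<bar>E - E0\<bar> < min r \<mu>"
    unfolding eventually_nhds_metric dist_real_def using r(1) \<mu>(1) by (intro exI[of _ "min r \<mu>"]) auto
  have belowE: "V x < E" if E: "\<bar>T E - xc\<bar> \<le> \<eta>" "V (T E) = E" "\<bar>E - E0\<bar> < min r \<mu>" and x: "x0 \<le> x" "x < T E" for E x
  proof (cases "x \<le> xc - \<eta>")
    case True
    then show ?thesis using \<mu>(2)[of x] E x by auto
  next
    case False
    then show ?thesis using inc'[of x "T E"] E x by auto
  qed
  have rem: "\<bar>I E - N E\<bar> \<le> sqrt (2 * \<bar>E - E0\<bar>) * G / m * \<bar>E - E0\<bar>"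
    if E: "\<bar>T E - xc\<bar> \<le> \<eta>" "V (T E) = E" "\<bar>E - E0\<bar> < min r \<mu>" for E
  proof -
    have Er: "\<bar>E - E0\<bar> \<le> r" using E by simp
    have TX: "x0 < T E" "T E \<le> X" using E(1) \<eta> by (auto simp: X_def)
    have int: "(\<lambda>x. P E x * g E x) integrable_on {x0..y}" if "y \<le> X" for y
      using that by (intro integrable_continuous_interval continuous_intros cP continuous_on_subset[OF cg[OF Er]]) auto
    have I: "I E = integral {x0..T E} (\<lambda>x. P E x * g E x)"
      unfolding I_def
    proof (rule integral_cong)
      fix x assume "x \<in> {x0..T E}"
      then have "V x \<le> E" using belowE[OF E, of x] E(2) by (cases "x = T E") auto
      then show "sqrt (2 * (E - V x)) * g E x = P E x * g E x" by (simp add: P_def)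
    qed
    show ?thesis
    proof (cases "T E \<le> xc")
      case True
      have "integral {x0..T E} (\<lambda>x. P E x * g E x) + integral {T E..xc} (\<lambda>x. P E x * g E x) = N E"
        unfolding Nsub[OF Er] using TX True \<eta> int[of xc]
        by (intro Henstock_Kurzweil_Integration.integral_combine) (auto simp: X_def)
      moreover have "integral {T E..xc} (\<lambda>x. P E x * g E x) = integral {T E..xc} (\<lambda>x. 0)"
      proof (rule integral_cong)
        fix x assume x: "x \<in> {T E..xc}"
        then have "E \<le> V x" using inc'[of "T E" x] E by (cases "x = T E") auto
        then show "P E x * g E x = 0" by (simp add: P_def)
      qed
      ultimately have "I E = N E" using I by simp
      then show ?thesis using G(1) m by simp
    next
      case False
      have "N E + integral {xc..T E} (\<lambda>x. P E x * g E x) = I E"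
        unfolding Nsub[OF Er] I using TX False x0c int[of "T E"]
        by (intro Henstock_Kurzweil_Integration.integral_combine) auto
      moreover have "norm (integral {xc..T E} (\<lambda>x. P E x * g E x)) \<le> (sqrt (2 * \<bar>E - E0\<bar>) * G) * (T E - xc)"
      proof (rule integral_bound)
        show "continuous_on {xc..T E} (\<lambda>x. P E x * g E x)"
          by (intro continuous_intros cP continuous_on_subset[OF cg[OF Er]]) (use TX x0c in auto)
        fix x assume x: "x \<in> {xc..T E}"
        have "E0 \<le> V x" using inc'[of xc x] x E(1) Vc \<eta> by (cases "x = xc") auto
        then have "P E x \<le> sqrt (2 * \<bar>E - E0\<bar>)"
          unfolding P_def using abs_ge_self[of "E - E0"] by (intro real_sqrt_le_mono max.boundedI) (simp_all only: abs_ge_zero zero_le_mult_iff mult_le_cancel_left, auto)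
        moreover have "\<bar>g E x\<bar> \<le> G" using x TX x0c by (intro gG[OF Er]) auto
        moreover have "P E x \<ge> 0" by (simp add: P_def)
        ultimately show "norm (P E x * g E x) \<le> sqrt (2 * \<bar>E - E0\<bar>) * G"
          by (auto simp: abs_mult intro!: mult_mono)
      qed (use False in simp)
      moreover have "(sqrt (2 * \<bar>E - E0\<bar>) * G) * (T E - xc) \<le> (sqrt (2 * \<bar>E - E0\<bar>) * G) * (\<bar>E - E0\<bar> / m)"
      proof (rule mult_left_mono)
        have "m * (T E - xc) \<le> \<bar>E - E0\<bar>" using inc[of xc "T E"] False E Vc \<eta> by auto
        then show "T E - xc \<le> \<bar>E - E0\<bar> / m" using m by (simp add: le_divide_eq mult.commute)
      qed (use G(1) in simp)
      ultimately show ?thesis by simp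
    qed
  qed
  have dZ: "((\<lambda>E. I E - N E) has_real_derivative 0) (at E0)"
  proof -
    have Z0: "I E0 - N E0 = 0"
      using eventually_nhds_x_imp_x[OF T_near] rem[of E0] r(1) \<mu>(1) by simp
    have "((\<lambda>E. ((I E - N E) - (I E0 - N E0)) / (E - E0)) \<longlongrightarrow> 0) (at E0)"
    proof (rule Lim_null_comparison)
      have "((\<lambda>E. sqrt (2 * \<bar>E - E0\<bar>) * G / m) \<longlongrightarrow> sqrt (2 * \<bar>E0 - E0\<bar>) * G / m) (at E0)"
        using m by (intro tendsto_intros) auto
      then show "((\<lambda>E. sqrt (2 * \<bar>E - E0\<bar>) * G / m) \<longlongrightarrow> 0) (at E0)" by simp
      have "\<forall>\<^sub>F E in at E0. \<bar>T E - xc\<bar> \<le> \<eta> \<and> V (T E) = E" "\<forall>\<^sub>F E in at E0. \<bar>E - E0\<bar> < min r \<mu>"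
        "\<forall>\<^sub>F E in at E0. E \<noteq> E0"
        using T_near E_near by (auto simp: eventually_at_filter elim: eventually_mono)
      then show "\<forall>\<^sub>F E in at E0. norm (((I E - N E) - (I E0 - N E0)) / (E - E0)) \<le> sqrt (2 * \<bar>E - E0\<bar>) * G / m"
      proof eventually_elim
        case (elim E)
        then show ?case using rem[of E] unfolding Z0 by (simp add: divide_le_eq)
      qed
    qed
    then show ?thesis unfolding has_field_derivative_iff .
  qed
  define B where "B E = sqrt (2 * (E - V x0)) * V1 x0 / R E x0" for E
  have wa: "w a > 0" "2 * (E0 - V x0) = (w a)\<^sup>2" using wpos[of a] w2[of a] ac by (auto simp: x0_def)
  have Ra: "R E0 x0 = (w a)\<^sup>2 + (V1 x0)\<^sup>2" "R E0 x0 \<noteq> 0" using wa R0[of x0] x0c by (auto simp: R_def)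
  have dB: "(B has_real_derivative V1 x0 / (w a * R E0 x0) - 2 * w a * V1 x0 / (R E0 x0)\<^sup>2) (at E0)"
  proof -
    have "((\<lambda>E. sqrt (2 * (E - V x0))) has_real_derivative 1 / w a) (at E0)"
    proof -
      have "0 < E0 - V x0" using below x0c by simp
      moreover have "sqrt (2 * (E0 - V x0)) = w a" using wa by simp
      ultimately show ?thesis using wa(1) by (auto intro!: derivative_eq_intros simp: divide_simps)
    qed
    then have "(B has_real_derivative (1 / w a * V1 x0 * R E0 x0 - sqrt (2 * (E0 - V x0)) * V1 x0 * 2) / (R E0 x0 * R E0 x0)) (at E0)"
      unfolding B_def using Ra by (intro DERIV_divide DERIV_cmult_right dR) auto
    also have "(1 / w a * V1 x0 * R E0 x0 - sqrt (2 * (E0 - V x0)) * V1 x0 * 2) / (R E0 x0 * R E0 x0)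
      = V1 x0 / (w a * R E0 x0) - 2 * w a * V1 x0 / (R E0 x0)\<^sup>2"
      using wa Ra(2) by (simp add: field_simps power2_eq_square)
    finally show ?thesis .
  qed
  have half: "\<forall>\<^sub>F E in nhds E0. 1 / sqrt 2 * \<bar>LBINT x=\<theta> a..T E. 1 / sqrt (E - V x)\<bar> = B E + (N E + (I E - N E))"
    using T_near E_near
  proof eventually_elim
    case (elim E)
    have "x0 < T E" using elim \<eta> by auto
    moreover have "V1 (T E) \<noteq> 0" using near(1)[of "T E"] elim m by auto
    ultimately have "1 / sqrt 2 * \<bar>LBINT x=x0..T E. 1 / sqrt (E - V x)\<bar> = B E + I E"
      unfolding B_def I_def g_def R_def
      using elim belowE by (intro half_length_formula[OF V V1 V2]) auto
    then show ?case by (simp add: x0_def)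
  qed
  have "((\<lambda>E. B E + (N E + (I E - N E))) has_real_derivative
      V1 x0 / (w a * R E0 x0) - 2 * w a * V1 x0 / (R E0 x0)\<^sup>2 + (integral {a..c} L + 0)) (at E0)"
    by (intro DERIV_add dB dN dZ)
  then have D: "((\<lambda>E. 1 / sqrt 2 * \<bar>LBINT x=\<theta> a..T E. 1 / sqrt (E - V x)\<bar>) has_real_derivative
      V1 x0 / (w a * R E0 x0) - 2 * w a * V1 x0 / (R E0 x0)\<^sup>2 + (integral {a..c} L + 0)) (at E0)"
    using DERIV_cong_ev[OF refl half refl] by blast
  \<comment> \<open>Up to the kernel \<open>\<kappa>\<close>, the density \<open>L\<close> is the derivative of \<open>2 w w' / (w\<^sup>2 + w'\<^sup>2)\<^sup>2\<close>, which vanishes at \<open>c\<close>.\<close>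
  define \<rho> where "\<rho> s = (w s)\<^sup>2 + (V1 (\<theta> s))\<^sup>2" for s
  have R\<rho>: "R E0 (\<theta> s) = \<rho> s" if "s \<in> {a..c}" for s using w2[OF that] by (simp add: R_def \<rho>_def)
  have \<rho>0: "\<rho> s \<noteq> 0" if "s \<in> {a..c}" for s
    using R0[OF \<theta>range[OF that]] R\<rho>[OF that] by simp
  define \<kappa> where "\<kappa> s = jacobi_kernel (V2 (\<theta> s)) (w s) (V1 (\<theta> s))" for s
  have "((\<lambda>s. L s + \<kappa> s) has_integral (- 2 * w c * V1 (\<theta> c) / (\<rho> c)\<^sup>2) - (- 2 * w a * V1 (\<theta> a) / (\<rho> a)\<^sup>2)) {a..c}"
  proof (rule fundamental_theorem_of_calculus)
    fix s assume s: "s \<in> {a..c}"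
    have dV1: "((\<lambda>s. V1 (\<theta> s)) has_real_derivative V2 (\<theta> s) * w s) (at s within {a..c})"
      by (rule DERIV_chain2[OF V1 \<theta>[OF s]])
    have d\<rho>: "(\<rho> has_real_derivative - 2 * w s * V1 (\<theta> s) * (1 - V2 (\<theta> s))) (at s within {a..c})"
      unfolding \<rho>_def by (auto intro!: derivative_eq_intros w[OF s] dV1 simp: algebra_simps)
    have "((\<lambda>s. - 2 * w s * V1 (\<theta> s) / (\<rho> s)\<^sup>2) has_real_derivative
       ((- 2 * - V1 (\<theta> s) * V1 (\<theta> s) + V2 (\<theta> s) * w s * (- 2 * w s)) * (\<rho> s)\<^sup>2
        - (- 2 * w s * V1 (\<theta> s)) * (2 * \<rho> s * (- 2 * w s * V1 (\<theta> s) * (1 - V2 (\<theta> s))))) / ((\<rho> s)\<^sup>2 * (\<rho> s)\<^sup>2)) (at s within {a..c})"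
    proof (intro DERIV_divide DERIV_mult DERIV_cmult w[OF s] dV1)
      show "((\<lambda>s. (\<rho> s)\<^sup>2) has_real_derivative 2 * \<rho> s * (- 2 * w s * V1 (\<theta> s) * (1 - V2 (\<theta> s)))) (at s within {a..c})"
        by (auto intro!: derivative_eq_intros d\<rho>)
    qed (use \<rho>0[OF s] in simp)
    also have "((- 2 * - V1 (\<theta> s) * V1 (\<theta> s) + V2 (\<theta> s) * w s * (- 2 * w s)) * (\<rho> s)\<^sup>2
        - (- 2 * w s * V1 (\<theta> s)) * (2 * \<rho> s * (- 2 * w s * V1 (\<theta> s) * (1 - V2 (\<theta> s))))) / ((\<rho> s)\<^sup>2 * (\<rho> s)\<^sup>2)
       = L s + \<kappa> s"
    proof -
      have "((- 2 * - d * d + q * u * (- 2 * u)) * p\<^sup>2 - (- 2 * u * d) * (2 * p * (- 2 * u * d * (1 - q)))) / (p\<^sup>2 * p\<^sup>2)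
         = ((1 + q) * p + 2 * d\<^sup>2 * (1 - q)) / p\<^sup>2 + u\<^sup>2 * (- 2 * (1 + q) / p\<^sup>2 - 8 * d\<^sup>2 * (1 - q) / p ^ 3)
            + (1 - q) * (u\<^sup>2 - d\<^sup>2) / p\<^sup>2" if p: "p = u\<^sup>2 + d\<^sup>2" "p \<noteq> 0" for p q u d :: real
      proof -
        have "((- 2 * - d * d + q * u * (- 2 * u)) * p\<^sup>2 - (- 2 * u * d) * (2 * p * (- 2 * u * d * (1 - q)))) / (p\<^sup>2 * p\<^sup>2)
          = ((2 * d\<^sup>2 - 2 * q * u\<^sup>2) * p - 8 * u\<^sup>2 * d\<^sup>2 * (1 - q)) / p ^ 3"
          using p(2) by (simp add: field_simps power2_eq_square power3_eq_cube)
        also have "2 * d\<^sup>2 - 2 * q * u\<^sup>2 = (1 + q) * p + 2 * d\<^sup>2 * (1 - q) - 2 * u\<^sup>2 * (1 + q) + (1 - q) * (u\<^sup>2 - d\<^sup>2)"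
          unfolding p(1) by (simp add: algebra_simps)
        also have "((X - 2 * u\<^sup>2 * (1 + q) + Y) * p - 8 * u\<^sup>2 * d\<^sup>2 * (1 - q)) / p ^ 3
          = X / p\<^sup>2 + u\<^sup>2 * (- 2 * (1 + q) / p\<^sup>2 - 8 * d\<^sup>2 * (1 - q) / p ^ 3) + Y / p\<^sup>2" for X Y
          using p(2) by (simp add: field_simps power2_eq_square power3_eq_cube)
        finally show ?thesis .
      qed
      from this[of "\<rho> s" "w s" "V1 (\<theta> s)" "V2 (\<theta> s)"] show ?thesis
        unfolding L_def g_def g'_def regular_weight_def \<kappa>_def jacobi_kernel_def R\<rho>[OF s]
        using \<rho>0[OF s] unfolding \<rho>_def by blast
    qed
    finally show "((\<lambda>s. - 2 * w s * V1 (\<theta> s) / (\<rho> s)\<^sup>2) has_vector_derivative L s + \<kappa> s) (at s within {a..c})"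
      by (simp add: has_real_derivative_iff_has_vector_derivative)
  qed (use ac in simp)
  moreover have "\<kappa> integrable_on {a..c}"
    unfolding \<kappa>_def jacobi_kernel_def
    by (intro integrable_continuous_interval continuous_intros cw comp c\<theta>) (use \<rho>0 in \<open>auto simp: \<rho>_def\<close>)
  ultimately have "((\<lambda>s. (L s + \<kappa> s) - \<kappa> s) has_integral
      (- 2 * w c * V1 (\<theta> c) / (\<rho> c)\<^sup>2) - (- 2 * w a * V1 (\<theta> a) / (\<rho> a)\<^sup>2) - integral {a..c} \<kappa>) {a..c}"
    by (intro has_integral_diff) auto
  then have "integral {a..c} L = 2 * w a * V1 x0 / (R E0 x0)\<^sup>2 - integral {a..c} \<kappa>"
    using R\<rho>[of a] ac wc by (auto dest!: integral_unique simp: x0_def)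
  then show ?thesis using D Ra(1) by (simp add: x0_def \<kappa>_def[abs_def])
qed

lemma jacobi_kernel_minus: "jacobi_kernel q (- u) d = jacobi_kernel q u d" "jacobi_kernel q u (- d) = jacobi_kernel q u d"
  by (simp_all add: jacobi_kernel_def)

text \<open>
  For negative velocity, the reflection \<open>x \<mapsto> - x\<close> of the configuration space reduces the claim to the
  case of positive velocity.
\<close>

lemma half_length_derivative:
  fixes V V1 V2 \<theta> w T :: "real \<Rightarrow> real"
  assumes V: "\<And>x. (V has_real_derivative V1 x) (at x)"
    and V1: "\<And>x. (V1 has_real_derivative V2 x) (at x)"
    and V2: "continuous_on UNIV V2"
    and ac: "a < c"
    and \<theta>: "\<And>s. s \<in> {a..c} \<Longrightarrow> (\<theta> has_real_derivative w s) (at s within {a..c})"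
    and w: "\<And>s. s \<in> {a..c} \<Longrightarrow> (w has_real_derivative - V1 (\<theta> s)) (at s within {a..c})"
    and wnz: "\<And>s. a \<le> s \<Longrightarrow> s < c \<Longrightarrow> w s \<noteq> 0" and wc: "w c = 0"
    and E0: "\<And>s. s \<in> {a..c} \<Longrightarrow> (w s)\<^sup>2 / 2 + V (\<theta> s) = E0"
    and V1c: "V1 (\<theta> c) \<noteq> 0"
    and br: "turning_point_branch V E0 (\<theta> c) T"
  shows "((\<lambda>E. 1 / sqrt 2 * \<bar>LBINT x=\<theta> a..T E. 1 / sqrt (E - V x)\<bar>) has_real_derivative
     V1 (\<theta> a) / (w a * ((w a)\<^sup>2 + (V1 (\<theta> a))\<^sup>2))
     - integral {a..c} (\<lambda>s. jacobi_kernel (V2 (\<theta> s)) (w s) (V1 (\<theta> s)))) (at E0)"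
proof -
  have cw: "continuous_on {a..c} w" using DERIV_continuous_on[OF w] by auto
  have no_zero: "\<not> (\<exists>z. s \<le> z \<and> z \<le> r \<and> w z = 0)" if "a \<le> s" "r < c" for s r
    using wnz that by fastforce
  consider (pos) "\<And>s. a \<le> s \<Longrightarrow> s < c \<Longrightarrow> w s > 0" | (neg) "\<And>s. a \<le> s \<Longrightarrow> s < c \<Longrightarrow> w s < 0"
  proof (cases "w a > 0")
    case True
    have "w s > 0" if s: "a \<le> s" "s < c" for s
    proof (rule ccontr)
      assume "\<not> w s > 0"
      then have "\<exists>z\<ge>a. z \<le> s \<and> w z = 0"
        using True s by (intro IVT2') (auto intro: continuous_on_subset[OF cw])
      then show False using no_zero s by blast
    qed
    then show ?thesis using pos by blast
  next
    case False
    then have wa: "w a < 0" using wnz[of a] ac by simp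
    have "w s < 0" if s: "a \<le> s" "s < c" for s
    proof (rule ccontr)
      assume "\<not> w s < 0"
      then have "\<exists>z\<ge>a. z \<le> s \<and> w z = 0"
        using wa s by (intro IVT') (auto intro: continuous_on_subset[OF cw])
      then show False using no_zero s by blast
    qed
    then show ?thesis using neg by blast
  qed
  then show ?thesis
  proof cases
    case pos
    then show ?thesis using half_length_derivative_pos[OF V V1 V2 ac \<theta> w _ wc E0 V1c br] by blast
  next
    case neg
    define U U1 U2 where "U x = V (- x)" and "U1 x = - V1 (- x)" and "U2 x = V2 (- x)" for x
    have U: "(U has_real_derivative U1 x) (at x)" for x
      unfolding U_def U1_def using DERIV_chain2[OF V DERIV_minus[OF DERIV_ident], of x UNIV] by simp
    have U1: "(U1 has_real_derivative U2 x) (at x)" for x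
      unfolding U1_def U2_def using DERIV_minus[OF DERIV_chain2[OF V1 DERIV_minus[OF DERIV_ident], of x UNIV]] by simp
    have U2: "continuous_on UNIV U2"
      unfolding U2_def by (intro continuous_on_compose2[OF V2] continuous_intros) auto
    have br': "turning_point_branch U E0 (- \<theta> c) (\<lambda>E. - T E)"
    proof -
      obtain S where S: "open S" "\<theta> c \<in> S" "T E0 = \<theta> c"
        "\<forall>\<^sub>F E in nhds E0. T E \<in> S \<and> V (T E) = E \<and> (\<forall>x\<in>S. V x = E \<longrightarrow> x = T E)"
        using br by (auto simp: turning_point_branch_def)
      have "\<forall>\<^sub>F E in nhds E0. - T E \<in> uminus ` S \<and> U (- T E) = E \<and> (\<forall>x\<in>uminus ` S. U x = E \<longrightarrow> x = - T E)"
        using S(4) by eventually_elim (auto simp: U_def)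
      then show ?thesis
        unfolding turning_point_branch_def using S open_negations[of S]
        by (intro conjI exI[of _ "uminus ` S"]) auto
    qed
    have D: "((\<lambda>E. 1 / sqrt 2 * \<bar>LBINT x=- \<theta> a..- T E. 1 / sqrt (E - U x)\<bar>) has_real_derivative
       U1 (- \<theta> a) / (- w a * ((- w a)\<^sup>2 + (U1 (- \<theta> a))\<^sup>2))
       - integral {a..c} (\<lambda>s. jacobi_kernel (U2 (- \<theta> s)) (- w s) (U1 (- \<theta> s)))) (at E0)"
    proof (rule half_length_derivative_pos[OF U U1 U2 ac, where \<theta> = "\<lambda>s. - \<theta> s" and w = "\<lambda>s. - w s" and T = "\<lambda>E. - T E"])
      show "((\<lambda>s. - w s) has_real_derivative - U1 (- \<theta> s)) (at s within {a..c})" if "s \<in> {a..c}" for s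
        using DERIV_minus[OF w[OF that]] by (simp add: U1_def)
    qed (use neg wc E0 V1c br' DERIV_minus[OF \<theta>] in \<open>auto simp: U_def U1_def\<close>)
    have refl: "\<bar>LBINT x=- \<theta> a..- T E. 1 / sqrt (E - U x)\<bar> = \<bar>LBINT x=\<theta> a..T E. 1 / sqrt (E - V x)\<bar>" for E
    proof -
      have "(LBINT x=- \<theta> a..- T E. 1 / sqrt (E - U x)) = (LBINT x=T E..\<theta> a. 1 / sqrt (E - V x))"
        by (subst interval_integral_reflect) (simp add: U_def)
      then show ?thesis by (subst (2) interval_integral_endpoints_reverse) simp
    qed
    show ?thesis using D unfolding refl by (simp add: U1_def U2_def jacobi_kernel_minus)
  qed
qed

section \<open>The derivative of the length function\<close>

text \<open>
  The second half of the orbit, run backwards in time, is again an orbit that ends at the turning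
  point. Up to boundary terms the derivative is minus the integral of the regularized density of
  \<open>1 / w\<^sup>2\<close>; together with them it is the decrement from \<open>a\<close> to \<open>b\<close> of
  \<open>v / w\<close> for the second Jacobi solution \<open>v\<close>.
\<close>

lemma length_derivative:
  fixes V V1 V2 \<theta> w T :: "real \<Rightarrow> real"
  assumes V: "\<And>x. (V has_real_derivative V1 x) (at x)"
    and V1: "\<And>x. (V1 has_real_derivative V2 x) (at x)"
    and V2: "continuous_on UNIV V2"
    and c: "c \<in> {a<..<b}"
    and \<theta>: "\<And>s. s \<in> {a..b} \<Longrightarrow> (\<theta> has_real_derivative w s) (at s within {a..b})"
    and w: "\<And>s. s \<in> {a..b} \<Longrightarrow> (w has_real_derivative - V1 (\<theta> s)) (at s within {a..b})"
    and wnz: "\<And>s. s \<in> {a..b} \<Longrightarrow> s \<noteq> c \<Longrightarrow> w s \<noteq> 0" and wc: "w c = 0"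
    and E0: "\<And>s. s \<in> {a..b} \<Longrightarrow> (w s)\<^sup>2 / 2 + V (\<theta> s) = E0"
    and V1c: "V1 (\<theta> c) \<noteq> 0"
    and br: "turning_point_branch V E0 (\<theta> c) T"
  shows "(length_fun V (\<theta> a) (\<theta> b) T has_real_derivative
     V1 (\<theta> a) / (w a * ((w a)\<^sup>2 + (V1 (\<theta> a))\<^sup>2)) - V1 (\<theta> b) / (w b * ((w b)\<^sup>2 + (V1 (\<theta> b))\<^sup>2))
     - integral {a..b} (\<lambda>s. jacobi_kernel (V2 (\<theta> s)) (w s) (V1 (\<theta> s)))) (at E0)"
proof -
  define \<kappa> where "\<kappa> s = jacobi_kernel (V2 (\<theta> s)) (w s) (V1 (\<theta> s))" for s
  have left: "((\<lambda>E. 1 / sqrt 2 * \<bar>LBINT x=\<theta> a..T E. 1 / sqrt (E - V x)\<bar>) has_real_derivative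
     V1 (\<theta> a) / (w a * ((w a)\<^sup>2 + (V1 (\<theta> a))\<^sup>2)) - integral {a..c} \<kappa>) (at E0)"
    unfolding \<kappa>_def using c
    by (intro half_length_derivative[OF V V1 V2] DERIV_subset[OF \<theta>] DERIV_subset[OF w] wc E0 V1c br wnz) auto
  have "((\<lambda>E. 1 / sqrt 2 * \<bar>LBINT x=\<theta> (- (- b))..T E. 1 / sqrt (E - V x)\<bar>) has_real_derivative
     V1 (\<theta> (- (- b))) / (- w (- (- b)) * ((- w (- (- b)))\<^sup>2 + (V1 (\<theta> (- (- b))))\<^sup>2))
     - integral {-b..-c} (\<lambda>s. jacobi_kernel (V2 (\<theta> (- s))) (- w (- s)) (V1 (\<theta> (- s))))) (at E0)"
  proof (rule half_length_derivative[OF V V1 V2, where \<theta> = "\<lambda>s. \<theta> (- s)" and w = "\<lambda>s. - w (- s)"])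
    have im: "uminus ` {-b..-c} \<subseteq> {a..b}" using c by auto
    fix s assume s: "s \<in> {-b..-c}"
    then have s': "- s \<in> {a..b}" using c by auto
    have m: "(uminus has_real_derivative - 1) (at s within {-b..-c})" by (auto intro!: derivative_eq_intros)
    have chain: "((\<lambda>s. f (- s)) has_real_derivative - d) (at s within {-b..-c})"
      if "(f has_real_derivative d) (at (- s) within {a..b})" for f :: "real \<Rightarrow> real" and d
      using DERIV_image_chain[OF DERIV_subset[OF that im] m] by (simp add: o_def)
    show "((\<lambda>s. \<theta> (- s)) has_real_derivative - w (- s)) (at s within {-b..-c})"
      by (rule chain[OF \<theta>[OF s']])
    show "((\<lambda>s. - w (- s)) has_real_derivative - V1 (\<theta> (- s))) (at s within {-b..-c})"
      using DERIV_minus[OF chain[OF w[OF s']]] by simp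
    show "(- w (- s))\<^sup>2 / 2 + V (\<theta> (- s)) = E0" using E0[OF s'] by simp
  qed (use c wc V1c br wnz in auto)
  moreover have "integral {-b..-c} (\<lambda>s. jacobi_kernel (V2 (\<theta> (- s))) (- w (- s)) (V1 (\<theta> (- s)))) = integral {c..b} \<kappa>"
    using Henstock_Kurzweil_Integration.integral_reflect_real[of b c \<kappa>] by (simp add: jacobi_kernel_minus \<kappa>_def)
  ultimately have right: "((\<lambda>E. 1 / sqrt 2 * \<bar>LBINT x=\<theta> b..T E. 1 / sqrt (E - V x)\<bar>) has_real_derivative
     - V1 (\<theta> b) / (w b * ((w b)\<^sup>2 + (V1 (\<theta> b))\<^sup>2)) - integral {c..b} \<kappa>) (at E0)"
    by simp
  have "\<kappa> integrable_on {a..b}"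
  proof -
    have nz: "(w s)\<^sup>2 + (V1 (\<theta> s))\<^sup>2 \<noteq> 0" if "s \<in> {a..b}" for s
      using wnz[OF that] V1c by (cases "s = c") (auto simp: sum_power2_eq_zero_iff)
    have cV: "continuous_on UNIV V1" using V1 by (auto intro: continuous_at_imp_continuous_on DERIV_isCont)
    have c\<theta>: "continuous_on {a..b} \<theta>" "continuous_on {a..b} w"
      using DERIV_continuous_on[OF \<theta>] DERIV_continuous_on[OF w] by auto
    have "continuous_on {a..b} (\<lambda>s. V1 (\<theta> s))" "continuous_on {a..b} (\<lambda>s. V2 (\<theta> s))"
      using continuous_on_compose2[OF cV c\<theta>(1)] continuous_on_compose2[OF V2 c\<theta>(1)] by auto
    then show ?thesis unfolding \<kappa>_def jacobi_kernel_def
      by (intro integrable_continuous_interval continuous_intros c\<theta>) (use nz in auto)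
  qed
  then have "integral {a..b} \<kappa> = integral {a..c} \<kappa> + integral {c..b} \<kappa>"
    using c by (intro Henstock_Kurzweil_Integration.integral_combine[symmetric]) auto
  then show ?thesis
    using DERIV_add[OF left right] unfolding length_fun_def[abs_def] \<kappa>_def[symmetric] by (simp add: algebra_simps)
qed

section \<open>Stability of the stationary function\<close>

text \<open>
  If \<open>V'\<close> vanished at \<open>\<theta> c\<close>, then \<open>\<theta> c\<close> would be an equilibrium, and \<open>\<theta>\<close> would rest there by
  uniqueness for the initial value problem. The uniqueness is a Gronwall estimate for
  \<open>e = (\<theta> - \<theta> c)\<^sup>2 + w\<^sup>2\<close>.
\<close>

lemma turning_point_nondegenerate:
  fixes V1 V2 \<theta> w :: "real \<Rightarrow> real"
  assumes V1: "\<And>x. (V1 has_real_derivative V2 x) (at x)"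
    and V2: "continuous_on UNIV V2"
    and c: "c \<in> {a..<b}"
    and \<theta>: "\<And>s. s \<in> {a..b} \<Longrightarrow> (\<theta> has_real_derivative w s) (at s within {a..b})"
    and w: "\<And>s. s \<in> {a..b} \<Longrightarrow> (w has_real_derivative - V1 (\<theta> s)) (at s within {a..b})"
    and wc: "w c = 0" and wb: "w b \<noteq> 0"
  shows "V1 (\<theta> c) \<noteq> 0"
proof
  assume 0: "V1 (\<theta> c) = 0"
  have c\<theta>: "continuous_on {a..b} \<theta>" "continuous_on {a..b} w"
    using DERIV_continuous_on[OF \<theta>] DERIV_continuous_on[OF w] by auto
  obtain N where N: "N > 0" "\<And>s. s \<in> {a..b} \<Longrightarrow> \<bar>\<theta> s\<bar> \<le> N"
    using continuous_on_compact_bound[OF compact_Icc c\<theta>(1)] by metis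
  obtain \<Lambda> where \<Lambda>: "\<Lambda> > 0" "\<And>x. x \<in> {-N..N} \<Longrightarrow> \<bar>V2 x\<bar> \<le> \<Lambda>"
    using continuous_on_compact_bound[OF compact_Icc continuous_on_subset[OF V2], of "-N" N] by auto
  have lip: "\<bar>V1 (\<theta> s)\<bar> \<le> \<Lambda> * \<bar>\<theta> s - \<theta> c\<bar>" if s: "s \<in> {a..b}" for s
  proof -
    have "norm (V1 (\<theta> s) - V1 (\<theta> c)) \<le> \<Lambda> * norm (\<theta> s - \<theta> c)"
    proof (rule field_differentiable_bound[where S = "{-N..N}" and f' = V2])
      show "(V1 has_real_derivative V2 x) (at x within {-N..N})" if "x \<in> {-N..N}" for x
        by (rule has_field_derivative_at_within[OF V1])
    qed (use N(2)[OF s] N(2)[of c] c \<Lambda>(2) in \<open>auto simp: abs_le_iff\<close>)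
    then show ?thesis using 0 by simp
  qed
  define e where "e s = (\<theta> s - \<theta> c)\<^sup>2 + (w s)\<^sup>2" for s
  define f where "f s = e s * exp (- (1 + \<Lambda>) * s)" for s
  have "f b \<le> f c"
  proof (rule DERIV_nonpos_imp_decreasing_open[where f = f and a = c and b = b])
    have df: "(f has_real_derivative (2 * (\<theta> s - \<theta> c) * w s - 2 * w s * V1 (\<theta> s) - (1 + \<Lambda>) * e s) * exp (- (1 + \<Lambda>) * s))
        (at s within {a..b})" if "s \<in> {a..b}" for s
      unfolding f_def e_def by (auto intro!: derivative_eq_intros \<theta> w that simp: algebra_simps)
    have "continuous_on {a..b} f" using DERIV_continuous_on[OF df] by blast
    then show "continuous_on {c..b} f" by (rule continuous_on_subset) (use c in auto)
    fix s assume s: "c < s" "s < b"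
    have "(at s within {a..b}) = at s" using s c by (intro at_within_interior) auto
    moreover have "2 * (\<theta> s - \<theta> c) * w s - 2 * w s * V1 (\<theta> s) - (1 + \<Lambda>) * e s \<le> 0"
    proof -
      have "2 * (\<theta> s - \<theta> c) * w s - 2 * w s * V1 (\<theta> s) \<le> 2 * \<bar>\<theta> s - \<theta> c\<bar> * \<bar>w s\<bar> + 2 * \<bar>w s\<bar> * \<bar>V1 (\<theta> s)\<bar>"
      proof -
        have "(\<theta> s - \<theta> c) * w s \<le> \<bar>\<theta> s - \<theta> c\<bar> * \<bar>w s\<bar>" "- (w s * V1 (\<theta> s)) \<le> \<bar>w s\<bar> * \<bar>V1 (\<theta> s)\<bar>"
          using abs_ge_self[of "(\<theta> s - \<theta> c) * w s"] abs_ge_minus_self[of "w s * V1 (\<theta> s)"] by (auto simp: abs_mult)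
        then show ?thesis by linarith
      qed
      also have "\<dots> \<le> 2 * \<bar>\<theta> s - \<theta> c\<bar> * \<bar>w s\<bar> + 2 * \<bar>w s\<bar> * (\<Lambda> * \<bar>\<theta> s - \<theta> c\<bar>)"
        using lip[of s] s c by (intro add_left_mono mult_left_mono) auto
      also have "\<dots> = (1 + \<Lambda>) * (2 * \<bar>\<theta> s - \<theta> c\<bar> * \<bar>w s\<bar>)" by (simp add: algebra_simps)
      also have "\<dots> \<le> (1 + \<Lambda>) * e s"
        using sum_squares_bound[of "\<bar>\<theta> s - \<theta> c\<bar>" "\<bar>w s\<bar>"] \<Lambda>(1) unfolding e_def by (intro mult_left_mono) auto
      finally show ?thesis by simp
    qed
    ultimately show "\<exists>y. (f has_real_derivative y) (at s) \<and> y \<le> 0"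
      using df[of s] s c by (intro exI conjI) (auto simp: mult_le_0_iff)
  qed (use c in auto)
  moreover have "f c = 0" using wc by (simp add: f_def e_def)
  ultimately have "e b \<le> 0" by (simp add: f_def mult_le_0_iff)
  then show False using wb sum_power2_gt_zero_iff[of "\<theta> b - \<theta> c" "w b"] unfolding e_def by linarith
qed

text \<open>
  The energy along a fixed direction is governed by the sign of the second variation, as the first one
  vanishes.
\<close>

lemma second_variation_test:
  fixes V V1 V2 :: "real \<Rightarrow> real" and A :: real
  assumes V: "\<And>x. (V has_real_derivative V1 x) (at x)"
    and V1: "\<And>x. (V1 has_real_derivative V2 x) (at x)"
    and V2: "continuous_on UNIV V2"
    and ab: "a < b" and st: "stationary_dirichlet a b A V Ta Tb \<theta>"
    and ta: "\<tau> \<in> dirichlet_C2 a b"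
  defines "\<delta>2 \<equiv> integral {a..b} (\<lambda>s. (deriv_on {a..b} \<tau> s)\<^sup>2 - V2 (\<theta> s) * (\<tau> s)\<^sup>2)"
  shows "\<delta>2 > 0 \<Longrightarrow> \<exists>M>0. \<forall>\<epsilon>\<in>{-M..M} - {0}. energy a b A V (\<lambda>s. \<theta> s + \<epsilon> * \<tau> s) > energy a b A V \<theta>"
    and "\<delta>2 < 0 \<Longrightarrow> \<exists>M>0. \<forall>\<epsilon>\<in>{-M..M} - {0}. energy a b A V (\<lambda>s. \<theta> s + \<epsilon> * \<tau> s) < energy a b A V \<theta>"
proof -
  have th: "C1_on {a..b} \<theta>" using st by (simp add: stationary_dirichlet_def)
  have t: "C1_on {a..b} \<tau>" "\<tau> \<in> dirichlet_C1 a b"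
    using ta by (auto simp: dirichlet_C2_def dirichlet_C1_def C2_on_def)
  have "((\<lambda>\<epsilon>. energy a b A V (\<lambda>s. \<theta> s + \<epsilon> * \<tau> s)) has_real_derivative 0) (at 0)"
    using st t by (auto simp: stationary_dirichlet_def)
  then have \<delta>1: "integral {a..b} (\<lambda>s. (deriv_on {a..b} \<theta> s - A) * deriv_on {a..b} \<tau> s - V1 (\<theta> s) * \<tau> s) = 0"
    using energy_first_variation[OF V V1 V2 ab th t(1)] DERIV_unique by blast
  define J where "J \<epsilon> = energy a b A V (\<lambda>s. \<theta> s + \<epsilon> * \<tau> s)" for \<epsilon>
  have expansion: thesis if nz: "\<delta>2 \<noteq> 0" and *: "\<And>d. d > 0 \<Longrightarrow> (\<And>\<epsilon>. \<bar>\<epsilon>\<bar> \<le> d \<Longrightarrow> \<epsilon> \<noteq> 0 \<Longrightarrow>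
      \<bar>J \<epsilon> - energy a b A V \<theta> - \<epsilon>\<^sup>2 / 2 * \<delta>2\<bar> < \<epsilon>\<^sup>2 / 2 * \<bar>\<delta>2\<bar>) \<Longrightarrow> thesis" for thesis
  proof -
    have "\<bar>\<delta>2\<bar> / 4 > 0" using nz by simp
    from energy_expansion[OF V V1 V2 ab th t(1) this, of A, folded \<delta>2_def J_def, unfolded \<delta>1 mult_zero_right diff_zero]
    obtain d where d: "d > 0" "\<forall>\<epsilon>. \<bar>\<epsilon>\<bar> \<le> d \<longrightarrow>
      \<bar>J \<epsilon> - energy a b A V \<theta> - \<epsilon>\<^sup>2 / 2 * \<delta>2\<bar> \<le> \<bar>\<delta>2\<bar> / 4 * \<epsilon>\<^sup>2"
      by (elim exE conjE)
    show thesis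
    proof (rule *[OF d(1)])
      fix \<epsilon> :: real assume e: "\<bar>\<epsilon>\<bar> \<le> d" "\<epsilon> \<noteq> 0"
      have "\<bar>J \<epsilon> - energy a b A V \<theta> - \<epsilon>\<^sup>2 / 2 * \<delta>2\<bar> \<le> \<bar>\<delta>2\<bar> / 4 * \<epsilon>\<^sup>2" using d(2) e(1) by simp
      also have "\<dots> < \<epsilon>\<^sup>2 / 2 * \<bar>\<delta>2\<bar>"
        using mult_pos_pos[of "\<epsilon>\<^sup>2" "\<bar>\<delta>2\<bar>"] e(2) nz by (simp add: mult.commute)
      finally show "\<bar>J \<epsilon> - energy a b A V \<theta> - \<epsilon>\<^sup>2 / 2 * \<delta>2\<bar> < \<epsilon>\<^sup>2 / 2 * \<bar>\<delta>2\<bar>" .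
    qed
  qed
  show "\<exists>M>0. \<forall>\<epsilon>\<in>{-M..M} - {0}. energy a b A V (\<lambda>s. \<theta> s + \<epsilon> * \<tau> s) > energy a b A V \<theta>" if pos: "\<delta>2 > 0"
  proof -
    have "\<delta>2 \<noteq> 0" using pos by simp
    then obtain M where M: "M > 0" "\<And>\<epsilon>. \<bar>\<epsilon>\<bar> \<le> M \<Longrightarrow> \<epsilon> \<noteq> 0 \<Longrightarrow>
      \<bar>J \<epsilon> - energy a b A V \<theta> - \<epsilon>\<^sup>2 / 2 * \<delta>2\<bar> < \<epsilon>\<^sup>2 / 2 * \<bar>\<delta>2\<bar>"
      by (rule expansion) (rule that)
    show ?thesis
      unfolding J_def[symmetric]
    proof (intro exI[of _ M] conjI ballI M(1))
      fix \<epsilon> assume "\<epsilon> \<in> {-M..M} - {0}"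
      then have "\<bar>\<epsilon>\<bar> \<le> M" "\<epsilon> \<noteq> 0" by auto
      then have "\<bar>J \<epsilon> - energy a b A V \<theta> - \<epsilon>\<^sup>2 / 2 * \<delta>2\<bar> < \<epsilon>\<^sup>2 / 2 * \<delta>2"
        using M(2)[of \<epsilon>] pos by simp
      then show "J \<epsilon> > energy a b A V \<theta>" by linarith
    qed
  qed
  show "\<exists>M>0. \<forall>\<epsilon>\<in>{-M..M} - {0}. energy a b A V (\<lambda>s. \<theta> s + \<epsilon> * \<tau> s) < energy a b A V \<theta>" if neg: "\<delta>2 < 0"
  proof -
    have "\<delta>2 \<noteq> 0" using neg by simp
    then obtain M where M: "M > 0" "\<And>\<epsilon>. \<bar>\<epsilon>\<bar> \<le> M \<Longrightarrow> \<epsilon> \<noteq> 0 \<Longrightarrow>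
      \<bar>J \<epsilon> - energy a b A V \<theta> - \<epsilon>\<^sup>2 / 2 * \<delta>2\<bar> < \<epsilon>\<^sup>2 / 2 * \<bar>\<delta>2\<bar>"
      by (rule expansion) (rule that)
    show ?thesis
      unfolding J_def[symmetric]
    proof (intro exI[of _ M] conjI ballI M(1))
      fix \<epsilon> assume "\<epsilon> \<in> {-M..M} - {0}"
      then have "\<bar>\<epsilon>\<bar> \<le> M" "\<epsilon> \<noteq> 0" by auto
      then have "\<bar>J \<epsilon> - energy a b A V \<theta> - \<epsilon>\<^sup>2 / 2 * \<delta>2\<bar> < - (\<epsilon>\<^sup>2 / 2 * \<delta>2)"
        using M(2)[of \<epsilon>] neg by simp
      then show "J \<epsilon> < energy a b A V \<theta>" by linarith
    qed
  qed
qed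

theorem theorem2:
  fixes a b A Ta Tb c E0 :: real and V \<theta> T :: "real \<Rightarrow> real"
  assumes "a < b"
    and "C2_on UNIV V"
    and "\<And>x. \<not> (deriv V x = 0 \<and> deriv (deriv V) x = 0)"
    and "stationary_dirichlet a b A V Ta Tb \<theta>"
    and "crossing_index a b (phase_trajectory a b \<theta>) = 1"
    and "c \<in> {a<..<b}" and "deriv_on {a..b} \<theta> c = 0"
    and "E0 = pseudo_energy a b V \<theta>"
    and "turning_point_branch V E0 (\<theta> c) T"
  shows "(\<forall>D. (length_fun V (\<theta> a) (\<theta> b) T has_real_derivative D) (at E0) \<and> D > 0
            \<longrightarrow> locally_minimal (energy a b A V) (dirichlet_C2 a b) \<theta>)
       \<and> (\<forall>D. (length_fun V (\<theta> a) (\<theta> b) T has_real_derivative D) (at E0) \<and> D < 0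
            \<longrightarrow> \<not> locally_minimal (energy a b A V) (dirichlet_C2 a b) \<theta>)"
proof -
  define V1 V2 w where "V1 = deriv V" and "V2 = deriv (deriv V)" and "w = deriv_on {a..b} \<theta>"
  note ab = \<open>a < b\<close> and st = assms(4) and c = \<open>c \<in> {a<..<b}\<close>
  have V: "(V has_real_derivative V1 x) (at x)" and V1: "(V1 has_real_derivative V2 x) (at x)" for x
    using C2_on_UNIV_derivatives(1,2)[OF assms(2)] by (auto simp: V1_def V2_def)
  have V2: "continuous_on UNIV V2"
    using C2_on_UNIV_derivatives(3)[OF assms(2)] by (simp add: V2_def)
  have th: "C1_on {a..b} \<theta>" using st by (simp add: stationary_dirichlet_def)
  have \<theta>: "(\<theta> has_real_derivative w s) (at s within {a..b})" if "s \<in> {a..b}" for s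
    unfolding w_def by (rule C1_on_has_derivative[OF th that])
  have w: "(w has_real_derivative - V1 (\<theta> s)) (at s within {a..b})" if "s \<in> {a..b}" for s
    unfolding w_def by (rule stationary_imp_ode[OF V V1 V2 ab st that])
  have wc: "w c = 0" using assms(7) by (simp add: w_def)
  have "card {s \<in> {a..b}. w s = 0} = 1"
    using assms(5) by (simp add: crossing_index_def phase_trajectory_def w_def)
  then obtain z where "{s \<in> {a..b}. w s = 0} = {z}" by (auto simp: card_1_singleton_iff)
  moreover from this have "z = c" using wc c by auto
  ultimately have wnz: "w s \<noteq> 0" if "s \<in> {a..b}" "s \<noteq> c" for s using that by auto
  have E0: "(w s)\<^sup>2 / 2 + V (\<theta> s) = E0" if s: "s \<in> {a..b}" for s
  proof -
    have "((\<lambda>s. (w s)\<^sup>2 / 2 + V (\<theta> s)) has_real_derivative 0) (at s within {a..b})" if "s \<in> {a..b}" for s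
      by (auto intro!: derivative_eq_intros w[OF that] DERIV_chain2[OF V \<theta>[OF that]])
    then have "\<exists>C. \<forall>s\<in>{a..b}. (w s)\<^sup>2 / 2 + V (\<theta> s) = C"
      by (intro has_field_derivative_zero_constant) auto
    then obtain C where C: "\<forall>s\<in>{a..b}. (w s)\<^sup>2 / 2 + V (\<theta> s) = C" by blast
    then have "pseudo_energy a b V \<theta> = C"
      unfolding pseudo_energy_def w_def[symmetric] using ab by (intro the_equality) auto
    then show ?thesis using C s assms(8) by simp
  qed
  have V1c: "V1 (\<theta> c) \<noteq> 0"
    by (rule turning_point_nondegenerate[OF V1 V2 _ \<theta> w wc]) (use c wnz in auto)
  define q where "q s = V2 (\<theta> s)" for s
  have q: "continuous_on {a..b} q"
    unfolding q_def by (rule continuous_on_compose2[OF V2 C1_on_continuous[OF th]]) auto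
  \<comment> \<open>Differentiating the equation of motion: \<open>w = \<theta>'\<close> solves the Jacobi equation.\<close>
  have p: "((\<lambda>s. - V1 (\<theta> s)) has_real_derivative - q s * w s) (at s within {a..b})" if "s \<in> {a..b}" for s
    using DERIV_minus[OF DERIV_chain2[OF V1 \<theta>[OF that]]] by (simp add: q_def)
  have R: "(w s)\<^sup>2 + (- V1 (\<theta> s))\<^sup>2 > 0" if "s \<in> {a..b}" for s
    using wnz[OF that] V1c by (cases "s = c") (auto simp: sum_power2_gt_zero_iff)
  obtain v y where
    v: "\<And>s. s \<in> {a..b} \<Longrightarrow> (v has_real_derivative y s) (at s within {a..b})" and
    y: "\<And>s. s \<in> {a..b} \<Longrightarrow> (y has_real_derivative - q s * v s) (at s within {a..b})" and
    W: "\<And>s. s \<in> {a..b} \<Longrightarrow> w s * y s - (- V1 (\<theta> s)) * v s = 1" and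
    D0: "w a \<noteq> 0 \<Longrightarrow> w b \<noteq> 0 \<Longrightarrow> v a / w a - v b / w b =
       - V1 (\<theta> b) / (w b * ((w b)\<^sup>2 + (- V1 (\<theta> b))\<^sup>2)) - - V1 (\<theta> a) / (w a * ((w a)\<^sup>2 + (- V1 (\<theta> a))\<^sup>2))
       - integral {a..b} (\<lambda>s. jacobi_kernel (q s) (w s) (- V1 (\<theta> s)))"
    by (rule jacobi_second_solution[OF ab w p q R]) (assumption | rule that)+
  have wab: "w a \<noteq> 0" "w b \<noteq> 0" using wnz[of a] wnz[of b] c by auto
  have "(length_fun V (\<theta> a) (\<theta> b) T has_real_derivative v a / w a - v b / w b) (at E0)"
  proof -
    have "v a / w a - v b / w b = V1 (\<theta> a) / (w a * ((w a)\<^sup>2 + (V1 (\<theta> a))\<^sup>2))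
       - V1 (\<theta> b) / (w b * ((w b)\<^sup>2 + (V1 (\<theta> b))\<^sup>2))
       - integral {a..b} (\<lambda>s. jacobi_kernel (V2 (\<theta> s)) (w s) (V1 (\<theta> s)))"
      using D0[OF wab] by (simp add: q_def jacobi_kernel_minus)
    then show ?thesis
      using length_derivative[OF V V1 V2 c \<theta> w wnz wc E0 V1c assms(9)] by simp
  qed
  then have D: "D = v a / w a - v b / w b"
    if "(length_fun V (\<theta> a) (\<theta> b) T has_real_derivative D) (at E0)" for D
    using DERIV_unique that by blast
  show ?thesis
  proof (intro conjI allI impI)
    fix D assume "(length_fun V (\<theta> a) (\<theta> b) T has_real_derivative D) (at E0) \<and> D > 0"
    then have pos: "v a / w a - v b / w b > 0" using D by blast
    show "locally_minimal (energy a b A V) (dirichlet_C2 a b) \<theta>"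
      unfolding locally_minimal_def
    proof
      fix \<tau> assume t: "\<tau> \<in> dirichlet_C2 a b"
      then have C1: "C1_on {a..b} \<tau>" and t0: "\<tau> a = 0" "\<tau> b = 0" "\<exists>s\<in>{a..b}. \<tau> s \<noteq> 0"
        by (auto simp: dirichlet_C2_def C2_on_def)
      have ct: "continuous_on {a..b} (deriv_on {a..b} \<tau>)" using C1 by (simp add: C1_on_def)
      obtain s0 where s0: "s0 \<in> {a..b}" "\<tau> s0 \<noteq> 0" using t0(3) by blast
      have "integral {a..b} (\<lambda>s. (deriv_on {a..b} \<tau> s)\<^sup>2 - q s * (\<tau> s)\<^sup>2) > 0"
        by (rule second_variation_pos[OF ab c w p q v y W wc wnz pos C1_on_has_derivative[OF C1] ct t0(1,2) s0])
      then show "\<exists>M>0. \<forall>\<epsilon>\<in>{-M..M} - {0}. energy a b A V \<theta> < energy a b A V (\<lambda>s. \<theta> s + \<epsilon> * \<tau> s)"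
        using second_variation_test(1)[OF V V1 V2 ab st t] by (simp add: q_def)
    qed
  next
    fix D assume "(length_fun V (\<theta> a) (\<theta> b) T has_real_derivative D) (at E0) \<and> D < 0"
    then have neg: "v a / w a - v b / w b < 0" using D by blast
    obtain \<tau> where t: "\<tau> \<in> dirichlet_C2 a b"
      and "integral {a..b} (\<lambda>s. (deriv_on {a..b} \<tau> s)\<^sup>2 - q s * (\<tau> s)\<^sup>2) < 0"
      using second_variation_neg[OF ab c w p q v y W wc wab neg] by blast
    then obtain M where M: "M > 0"
      "\<And>\<epsilon>. \<epsilon> \<in> {-M..M} - {0} \<Longrightarrow> energy a b A V (\<lambda>s. \<theta> s + \<epsilon> * \<tau> s) < energy a b A V \<theta>"
      using second_variation_test(2)[OF V V1 V2 ab st t] by (auto simp: q_def)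
    show "\<not> locally_minimal (energy a b A V) (dirichlet_C2 a b) \<theta>"
    proof
      assume "locally_minimal (energy a b A V) (dirichlet_C2 a b) \<theta>"
      then obtain M' where M': "M' > 0"
        "\<And>\<epsilon>. \<epsilon> \<in> {-M'..M'} - {0} \<Longrightarrow> energy a b A V \<theta> < energy a b A V (\<lambda>s. \<theta> s + \<epsilon> * \<tau> s)"
        using t by (auto simp: locally_minimal_def)
      have "min M M' \<in> {-M..M} - {0}" "min M M' \<in> {-M'..M'} - {0}" using M(1) M'(1) by auto
      from M(2)[OF this(1)] M'(2)[OF this(2)] show False by simp
    qed
  qed
qed

end
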